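(* Let $K$ be an algebraically closed field, let $c,d\ge 2$ be integers, let $R=K[x_0,\dots,x_c,y_0,\dots,y_d]$ be the polynomial ring in $c+d+2$ indeterminates, and let $I_{c,d}$ be the ideal of $R$ generated by the 2-minors of $$A_{c,d}=\begin{pmatrix} x_0&x_1&\dots&x_{c-1}&y_0&y_1&\dots&y_{d-1}\\ x_1&x_2&\dots&x_c&y_1&y_2&\dots&y_d\end{pmatrix}.$$ Put $$F_i=\sum_{k=0}^i(-1)^k\binom{i}{k}x_{i+1}^{i-k}x_kx_i^k\quad (1\le i\le c-1),\qquad F_c=\sum_{k=0}^c(-1)^k\binom{c}{k}y_1^{c-k}x_ky_0^k,$$ $$G_i=\sum_{k=0}^i(-1)^k\binom{i}{k}y_{i+1}^{i-k}y_ky_i^k\quad (1\le i\le d-1).$$ Then $$I_{c,d}=\operatorname{Rad}(F_1,\dots,F_{c-1},F_c,G_1,\dots,G_{d-1},x_0y_d-x_1y_{d-1}).$$ In particular, $I_{c,d}$ is an almost set-theoretic complete intersection.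
   Context: $\operatorname{Rad}$ denotes the radical of an ideal. Elements $P_1,\dots,P_s\in R$ are said to generate an ideal $I$ up to radical if $\operatorname{Rad}(P_1,\dots,P_s)=\operatorname{Rad}(I)$. An ideal $I$ is called an almost set-theoretic complete intersection if it can be generated up to radical by $s$ elements with $s\le \operatorname{height}(I)+1$. Note that $F_c$ is defined by a different formula from $F_1,\dots,F_{c-1}$. In this setting $I_{c,d}$ is a prime ideal of height $c+d-1$. *)

theory Defs
  imports
    "HOL-Library.Poly_Mapping"
    "HOL-Library.Extended_Nat"
    "HOL-Computational_Algebra.Polynomial"
    "HOL-Algebra.Ideal"
    "Jordan_Normal_Form.Determinant"
    "Jordan_Normal_Form.DL_Submatrix"
begin

text \<open>
  A polynomial is a finitely supported map from exponent vectors to coefficients. The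
  indeterminates are indexed by natural numbers; the polynomial ring in a prescribed set
  \<open>V\<close> of indeterminates is the subring of those polynomials all of whose monomials only
  involve indeterminates from \<open>V\<close>.
\<close>

type_synonym 'k mpoly = "(nat \<Rightarrow>\<^sub>0 nat) \<Rightarrow>\<^sub>0 'k"

definition indet :: "nat \<Rightarrow> 'k::comm_ring_1 mpoly" where
  "indet i = Poly_Mapping.single (Poly_Mapping.single i 1) 1"

definition mpoly_ring :: "nat set \<Rightarrow> 'k::comm_ring_1 mpoly ring" where
  "mpoly_ring V =
     \<lparr>carrier = {p. \<forall>m \<in> Poly_Mapping.keys p. Poly_Mapping.keys m \<subseteq> V},
      monoid.mult = (*), one = 1, ring.zero = 0, add = (+)\<rparr>"

lemma cring_mpoly_ring: "cring (mpoly_ring V :: 'k::comm_ring_1 mpoly ring)"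
proof -
  let ?R = "mpoly_ring V :: 'k mpoly ring"
  have add: "p \<oplus>\<^bsub>?R\<^esub> q \<in> carrier ?R" if "p \<in> carrier ?R" "q \<in> carrier ?R" for p q
    using that Poly_Mapping.keys_add[of p q] unfolding mpoly_ring_def by auto
  have mult: "p \<otimes>\<^bsub>?R\<^esub> q \<in> carrier ?R" if p: "p \<in> carrier ?R" and q: "q \<in> carrier ?R" for p q
  proof -
    have "Poly_Mapping.keys m \<subseteq> V" if mk: "m \<in> Poly_Mapping.keys (p * q)" for m
    proof -
      obtain a b where m: "m = a + b" "a \<in> Poly_Mapping.keys p" "b \<in> Poly_Mapping.keys q"
        using subsetD[OF keys_mult mk] by blast
      then have "Poly_Mapping.keys a \<subseteq> V" "Poly_Mapping.keys b \<subseteq> V"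
        using p q by (simp_all add: mpoly_ring_def)
      then show ?thesis
        using Poly_Mapping.keys_add[of a b] m(1) by auto
    qed
    then show ?thesis by (simp add: mpoly_ring_def)
  qed
  have uminus: "- p \<in> carrier ?R" if "p \<in> carrier ?R" for p
    using that by (simp add: mpoly_ring_def in_keys_iff)
  have zero: "\<zero>\<^bsub>?R\<^esub> \<in> carrier ?R" and one: "\<one>\<^bsub>?R\<^esub> \<in> carrier ?R"
    by (simp_all add: mpoly_ring_def)
  have "abelian_group ?R"
  proof (rule abelian_groupI)
    fix x assume x: "x \<in> carrier ?R"
    have "- x \<oplus>\<^bsub>?R\<^esub> x = \<zero>\<^bsub>?R\<^esub>"
      by (simp add: mpoly_ring_def)
    then show "\<exists>y\<in>carrier ?R. y \<oplus>\<^bsub>?R\<^esub> x = \<zero>\<^bsub>?R\<^esub>"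
      using uminus[OF x] by (rule bexI)
  qed (simp_all add: add zero, simp_all add: mpoly_ring_def ac_simps)
  moreover have "comm_monoid ?R"
    by (rule comm_monoidI)
      (simp_all add: mult one, simp_all add: mpoly_ring_def ac_simps)
  ultimately show ?thesis
    by (rule cringI) (simp add: mpoly_ring_def distrib_right)
qed

definition Rad :: "('a, 'b) ring_scheme \<Rightarrow> 'a set \<Rightarrow> 'a set" where
  "Rad R I = {a \<in> carrier R. \<exists>n::nat. n \<ge> 1 \<and> a [^]\<^bsub>R\<^esub> n \<in> I}"

definition height_prime :: "('a, 'b) ring_scheme \<Rightarrow> 'a set \<Rightarrow> enat" where
  "height_prime R P =
     Sup {enat n | n. \<exists>Q :: nat \<Rightarrow> 'a set.
            (\<forall>i\<le>n. primeideal (Q i) R) \<and> (\<forall>i<n. Q i \<subset> Q (Suc i)) \<and> Q n = P}"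

definition height :: "('a, 'b) ring_scheme \<Rightarrow> 'a set \<Rightarrow> enat" where
  "height R I = Inf {height_prime R P | P. primeideal P R \<and> I \<subseteq> P}"

definition generates_up_to_radical :: "('a, 'b) ring_scheme \<Rightarrow> 'a list \<Rightarrow> 'a set \<Rightarrow> bool" where
  "generates_up_to_radical R Ps I \<longleftrightarrow>
     set Ps \<subseteq> carrier R \<and> Rad R (Idl\<^bsub>R\<^esub> (set Ps)) = Rad R I"

definition almost_stci :: "('a, 'b) ring_scheme \<Rightarrow> 'a set \<Rightarrow> bool" where
  "almost_stci R I \<longleftrightarrow>
     ideal I R \<and> (\<exists>Ps. generates_up_to_radical R Ps I \<and> enat (length Ps) \<le> height R I + 1)"

definition minors :: "nat \<Rightarrow> 'a::comm_ring_1 mat \<Rightarrow> 'a set" where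
  "minors r A = {det (submatrix A S T) | S T.
     S \<subseteq> {..<dim_row A} \<and> T \<subseteq> {..<dim_col A} \<and> card S = r \<and> card T = r}"

text \<open>
  The indeterminates \<open>x\<^sub>0, \<dots>, x\<^sub>c, y\<^sub>0, \<dots>, y\<^sub>d\<close> are those with indices
  \<open>0, \<dots>, c, c + 1, \<dots>, c + d + 1\<close>, in this order.
\<close>

definition xvar :: "nat \<Rightarrow> 'k::comm_ring_1 mpoly" where
  "xvar i = indet i"

definition yvar :: "nat \<Rightarrow> nat \<Rightarrow> 'k::comm_ring_1 mpoly" where
  "yvar c j = indet (c + 1 + j)"

definition R_ring :: "nat \<Rightarrow> nat \<Rightarrow> 'k::comm_ring_1 mpoly ring" where
  "R_ring c d = mpoly_ring {..<c + d + 2}"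

definition A_mat :: "nat \<Rightarrow> nat \<Rightarrow> 'k::comm_ring_1 mpoly mat" where
  "A_mat c d = mat 2 (c + d)
     (\<lambda>(r, j). if j < c then xvar (j + r) else yvar c (j - c + r))"

definition I_ideal :: "nat \<Rightarrow> nat \<Rightarrow> 'k::comm_ring_1 mpoly set" where
  "I_ideal c d = Idl\<^bsub>R_ring c d\<^esub> (minors 2 (A_mat c d))"

text \<open>The case \<open>i = c\<close> is given by \<open>F_last\<close>, not by \<open>F_poly\<close>.\<close>

definition F_poly :: "nat \<Rightarrow> 'k::comm_ring_1 mpoly" where
  "F_poly i = (\<Sum>k = 0..i. (-1) ^ k * of_nat (i choose k)
     * xvar (i + 1) ^ (i - k) * xvar k * xvar i ^ k)"

definition F_last :: "nat \<Rightarrow> 'k::comm_ring_1 mpoly" where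
  "F_last c = (\<Sum>k = 0..c. (-1) ^ k * of_nat (c choose k)
     * yvar c 1 ^ (c - k) * xvar k * yvar c 0 ^ k)"

definition G_poly :: "nat \<Rightarrow> nat \<Rightarrow> 'k::comm_ring_1 mpoly" where
  "G_poly c i = (\<Sum>k = 0..i. (-1) ^ k * of_nat (i choose k)
     * yvar c (i + 1) ^ (i - k) * yvar c k * yvar c i ^ k)"

end

(*
  The ideal I of minors is the kernel of the toric parametrization x_i -> u t^i, y_j -> v t^j:
  two monomials with the same image are connected by exchanges z_i z_(j+1) <-> z_(i+1) z_j, each of
  which is a multiple of a minor. Hence I is prime, and specializing the indeterminates other than
  x_0, x_1, y_0 one at a time gives a chain of c + d - 1 strict inclusions of primes ending at I.

  The generators lie in the kernel, because on x_k = s t^k each alternating sum is s (a - t b)^n by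
  the binomial theorem. Conversely, let P be a prime containing them. If x_0 is not in P, the same
  identity, applied inductively modulo P, gives x_0 q = x_1 p for every column (p, q) of the matrix.
  If x_0 is in P, the last terms of the sums force x_0, ..., x_(c-1) into P, and then x_c or y_0.
  Either way all minors lie in P, and the radical is the intersection of such P.
*)
theory Submission
  imports Defs "HOL-Algebra.Ring_Divisibility"
begin

text \<open>Each F_i with i < c and each G_i involves one block of columns only, and once the first
  entry of a block vanishes these forms leave its last entry free. F_c links the blocks: it gives
  x_0 y_1 = x_1 y_0 where x_0 is nonzero, and x_c y_0^c = 0 where all earlier x_k vanish. The
  quadric x_0 y_d - x_1 y_(d-1) closes the remaining gap, x_0 nonzero and y_0 = 0, where it forces
  y_d = 0. Arbitrary primes stand in for the points of the variety. The ratio x_1/x_0 does not exist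
  modulo a prime, so denominators are cleared and a factor outside the prime is cancelled at the
  end. The characteristic is harmless: the sums collapse to full powers, or to a last term with
  coefficient 1 or -1. The kernel description serves three ends: primality of I, membership of the
  generators by substitution, and the top of the chain. There are c + d generators, so a height of
  at least c + d - 1 is what the final claim asks for.\<close>

section \<open>Primes avoiding the powers of an element\<close>

text \<open>Zorn, applied to the ideals over \<open>J\<close> that miss every power of
  \<open>a\<close>. A maximal one is prime: adjoining \<open>x\<close> or \<open>y\<close> from
  outside catches a power of \<open>a\<close> each, and the product of these powers is congruent to
  a multiple of the product of \<open>x\<close> and \<open>y\<close>.\<close>

lemma (in cring) exists_primeideal_avoiding_powers:
  assumes J: "ideal J R" and a: "a \<in> carrier R"
    and av: "\<And>n::nat. n \<ge> 1 \<Longrightarrow> a [^] n \<notin> J"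
  shows "\<exists>P. primeideal P R \<and> J \<subseteq> P \<and> a \<notin> P"
proof -
  \<comment> \<open>Exponent 0 is included, so all members are proper ideals. For \<open>J\<close>
    itself this holds because containing 1 would put \<open>a\<close> into \<open>J\<close>.\<close>
  define A where "A = {I. ideal I R \<and> J \<subseteq> I \<and> (\<forall>n::nat. a [^] n \<notin> I)}"
  have "a [^] (0::nat) \<notin> J"
    using av[of 1] a ideal.one_imp_carrier[OF J] by auto
  then have "a [^] n \<notin> J" for n :: nat
    using av by (cases "n = 0") auto
  then have JA: "J \<in> A"
    using J by (simp add: A_def)
  have "\<exists>M\<in>A. \<forall>X\<in>A. M \<subseteq> X \<longrightarrow> X = M"
  proof (rule subset_Zorn_nonempty)
    show "A \<noteq> {}" using JA by blast
  next
    fix C assume C: "C \<noteq> {}" "subset.chain A C"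
    then have CA: "C \<subseteq> A" and ch: "subset.chain {I. ideal I R} C"
      by (auto simp: subset.chain_def A_def)
    have "ideal (\<Union>C) R"
      using chain_Union_is_ideal[OF ch] C(1) by simp
    then show "\<Union>C \<in> A"
      using C(1) CA unfolding A_def by blast
  qed
  then obtain M where M: "M \<in> A" and max: "\<And>X. X \<in> A \<Longrightarrow> M \<subseteq> X \<Longrightarrow> X = M"
    by blast
  interpret M: ideal M R using M by (simp add: A_def)
  have power_in: "\<exists>n::nat. \<exists>m\<in>M. \<exists>r\<in>carrier R. a [^] n = m \<oplus> r \<otimes> x"
    if x: "x \<in> carrier R" "x \<notin> M" for x
  proof -
    let ?N = "M <+>\<^bsub>R\<^esub> PIdl x"
    have N: "ideal ?N R"
      by (rule add_ideals[OF M.is_ideal cgenideal_ideal[OF x(1)]])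
    have MN: "M \<subseteq> ?N"
    proof
      fix m assume "m \<in> M"
      moreover have "\<zero> \<in> PIdl x"
        using cgenideal_ideal[OF x(1)] by (simp add: additive_subgroup.zero_closed ideal.axioms(1))
      moreover have "m = m \<oplus> \<zero>" using \<open>m \<in> M\<close> M.Icarr by simp
      ultimately show "m \<in> ?N" unfolding set_add_def' by blast
    qed
    have "x \<in> ?N"
    proof -
      have "x = \<zero> \<oplus> x" using x by simp
      then show ?thesis
        using M.zero_closed cgenideal_self[OF x(1)] unfolding set_add_def' by blast
    qed
    then have "?N \<notin> A" using max[of ?N] MN x by blast
    then obtain n :: nat where "a [^] n \<in> ?N"
      using N MN M by (auto simp: A_def)
    then show ?thesis
      unfolding set_add_def' cgenideal_def by blast
  qed
  have "primeideal M R"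
  proof (rule primeidealI[OF M.is_ideal is_cring])
    show "carrier R \<noteq> M" using M a by (auto simp: A_def)
  next
    fix x y assume x: "x \<in> carrier R" and y: "y \<in> carrier R" and xy: "x \<otimes> y \<in> M"
    show "x \<in> M \<or> y \<in> M"
    proof (rule ccontr)
      assume "\<not> ?thesis"
      then obtain n k :: nat and m m' r s where *: "m \<in> M" "m' \<in> M" "r \<in> carrier R" "s \<in> carrier R"
        "a [^] n = m \<oplus> r \<otimes> x" "a [^] k = m' \<oplus> s \<otimes> y"
        using power_in[OF x] power_in[OF y] by blast
      have mc: "m \<in> carrier R" "m' \<in> carrier R" using * M.Icarr by auto
      have "a [^] (n + k) = (m \<oplus> r \<otimes> x) \<otimes> (m' \<oplus> s \<otimes> y)"
        using * a by (simp add: nat_pow_mult[symmetric])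
      \<comment> \<open>Grouped so that each summand has a factor in \<open>M\<close>:
        \<open>m\<close>, \<open>m'\<close>, or the product of \<open>x\<close> and
        \<open>y\<close>.\<close>
      also have "\<dots> = (m' \<oplus> s \<otimes> y) \<otimes> m \<oplus> (r \<otimes> x \<otimes> m' \<oplus> r \<otimes> s \<otimes> (x \<otimes> y))"
        using * x y mc by algebra
      also have "\<dots> \<in> M"
        by (rule M.a_closed[OF M.I_l_closed M.a_closed[OF M.I_l_closed M.I_l_closed]])
          (use * x y xy mc in auto)
      finally show False using M by (simp add: A_def)
    qed
  qed
  moreover have "a \<notin> M"
    using M a by (auto simp: A_def dest: spec[of _ 1])
  ultimately show ?thesis using M by (auto simp: A_def)
qed

section \<open>Monomial substitutions\<close>

text \<open>The map of monoid algebras induced by a map of exponents. Coefficients of monomials with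
  equal image add up, which is what creates a kernel.\<close>

definition push :: "('a \<Rightarrow> 'b) \<Rightarrow> ('a \<Rightarrow>\<^sub>0 'k::comm_monoid_add) \<Rightarrow> ('b \<Rightarrow>\<^sub>0 'k)" where
  "push w p = (\<Sum>m\<in>Poly_Mapping.keys p. Poly_Mapping.single (w m) (Poly_Mapping.lookup p m))"

text \<open>Lets polynomials with different supports be summed over one common index set, as
  additivity requires.\<close>

lemma push_superset:
  assumes "finite A" "Poly_Mapping.keys p \<subseteq> A"
  shows "push w p = (\<Sum>m\<in>A. Poly_Mapping.single (w m) (Poly_Mapping.lookup p m))"
  unfolding push_def by (rule sum.mono_neutral_left) (use assms in \<open>auto simp: in_keys_iff\<close>)

lemma push_zero [simp]: "push w 0 = 0"
  by (simp add: push_def)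

lemma push_single [simp]: "push w (Poly_Mapping.single m a) = Poly_Mapping.single (w m) a"
  by (simp add: push_def)

lemma push_add: "push w (p + q) = push w p + push w q"
proof -
  let ?A = "Poly_Mapping.keys p \<union> Poly_Mapping.keys q"
  have "push w f = (\<Sum>m\<in>?A. Poly_Mapping.single (w m) (Poly_Mapping.lookup f m))"
    if "Poly_Mapping.keys f \<subseteq> ?A" for f
    by (rule push_superset) (use that in auto)
  from this[of "p + q"] this[of p] this[of q] show ?thesis
    using Poly_Mapping.keys_add[of p q] by (simp add: lookup_add single_add sum.distrib)
qed

lemma push_sum: "push w (\<Sum>i\<in>A. f i) = (\<Sum>i\<in>A. push w (f i))"
  by (induction A rule: infinite_finite_induct) (simp_all add: push_add)

lemma push_uminus: "push w (- p) = - push w (p :: _ \<Rightarrow>\<^sub>0 'k::ab_group_add)"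
  using push_add[of w p "- p"] by (simp add: add_eq_0_iff)

lemma push_diff: "push w (p - q) = push w p - push w (q :: _ \<Rightarrow>\<^sub>0 'k::ab_group_add)"
  using push_add[of w p "- q"] by (simp add: push_uminus)

lemma sum_single_lookup:
  "(\<Sum>m\<in>Poly_Mapping.keys p. Poly_Mapping.single m (Poly_Mapping.lookup p m)) = p"
  by (rule poly_mapping_eqI)
    (simp add: lookup_sum lookup_single when_def in_keys_iff)

lemma push_push: "push v (push w p) = push (v \<circ> w) p"
  by (simp add: push_def[of w] push_sum) (simp add: push_def)

lemma lookup_push:
  "Poly_Mapping.lookup (push w p) n =
     (\<Sum>m\<in>{m \<in> Poly_Mapping.keys p. w m = n}. Poly_Mapping.lookup p m)"
  unfolding push_def lookup_sum lookup_single when_def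
  by (simp add: sum.inter_filter)

lemma push_mult:
  fixes p q :: "'a::monoid_add \<Rightarrow>\<^sub>0 'k::semiring_0"
  assumes w: "\<And>m n. w (m + n) = w m + (w n :: 'b::monoid_add)"
  shows "push w (p * q) = push w p * push w q"
proof -
  have "push w (p * q) = push w
     ((\<Sum>m\<in>Poly_Mapping.keys p. Poly_Mapping.single m (Poly_Mapping.lookup p m)) *
      (\<Sum>m\<in>Poly_Mapping.keys q. Poly_Mapping.single m (Poly_Mapping.lookup q m)))"
    by (simp add: sum_single_lookup)
  also have "\<dots> = push w p * push w q"
    by (simp add: push_def[of w p] push_def[of w q] sum_product push_sum mult_single w)
  finally show ?thesis .
qed

locale monomial_map =
  fixes w :: "'a::comm_monoid_add \<Rightarrow> 'b::comm_monoid_add"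
  assumes add: "w (m + n) = w m + w n" and zero: "w 0 = 0"
begin

lemma push_times: "push w (p * q) = push w p * push w (q :: 'a \<Rightarrow>\<^sub>0 'k::comm_ring_1)"
  by (rule push_mult) (rule add)

lemma push_one: "push w (1 :: 'a \<Rightarrow>\<^sub>0 'k::comm_ring_1) = 1"
  using push_single[of w 0 "1 :: 'k"] by (simp add: zero)

lemma push_power: "push w (p ^ n) = push w (p :: 'a \<Rightarrow>\<^sub>0 'k::comm_ring_1) ^ n"
  by (induction n) (simp_all add: push_one push_times)

lemma push_of_nat: "push w (of_nat n :: 'a \<Rightarrow>\<^sub>0 'k::comm_ring_1) = of_nat n"
  by (induction n) (simp_all add: push_one push_add)

lemmas push_hom = push_times push_one push_power push_of_nat push_sum push_uminus push_diff push_add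

end

section \<open>Vanishing of the minors modulo a prime\<close>

text \<open>The expansion of \<open>(a - t * b) ^ n\<close> with \<open>t ^ k\<close> replaced by
  \<open>z k\<close>; F_1, ..., F_c and G_1, ..., G_(d-1) all have this shape.\<close>

definition scroll_form :: "(nat \<Rightarrow> 'a::comm_ring_1) \<Rightarrow> 'a \<Rightarrow> 'a \<Rightarrow> nat \<Rightarrow> 'a" where
  "scroll_form z a b n = (\<Sum>k = 0..n. (-1) ^ k * of_nat (n choose k) * a ^ (n - k) * z k * b ^ k)"

lemma binomial_diff:
  fixes a b :: "'a::comm_ring_1"
  shows "(\<Sum>k = 0..n. (-1) ^ k * of_nat (n choose k) * a ^ (n - k) * b ^ k) = (a - b) ^ n"
proof -
  have "(a - b) ^ n = (- b + a) ^ n" by simp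
  also have "\<dots> = (\<Sum>k = 0..n. of_nat (n choose k) * (- b) ^ k * a ^ (n - k))"
    by (subst binomial_ring) (simp add: atLeast0AtMost)
  also have "\<dots> = (\<Sum>k = 0..n. (-1) ^ k * of_nat (n choose k) * a ^ (n - k) * b ^ k)"
    by (rule sum.cong) (simp_all add: power_minus[of b] ac_simps)
  finally show ?thesis ..
qed

lemma scroll_form_geometric:
  assumes "\<And>k. k \<le> n \<Longrightarrow> z k = s * t ^ k"
  shows "scroll_form z a b n = s * (a - t * b) ^ n"
  unfolding scroll_form_def binomial_diff[symmetric] sum_distrib_left
  by (rule sum.cong) (simp_all add: assms power_mult_distrib ac_simps)

section \<open>Computing with ideals of a subring\<close>

text \<open>\<open>C\<close> stands for the carrier of a polynomial ring in some of the
  indeterminates. As a subset of a type-class ring it admits the ordinary algebraic identities in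
  place of the operations of a ring record.\<close>

locale ideal_of_subring =
  fixes C P :: "'a::comm_ring_1 set"
  assumes one_C: "1 \<in> C"
    and add_C: "a \<in> C \<Longrightarrow> b \<in> C \<Longrightarrow> a + b \<in> C"
    and mult_C: "a \<in> C \<Longrightarrow> b \<in> C \<Longrightarrow> a * b \<in> C"
    and uminus_C: "a \<in> C \<Longrightarrow> - a \<in> C"
    and P_subset: "P \<subseteq> C"
    and zero_P: "0 \<in> P"
    and add_P: "a \<in> P \<Longrightarrow> b \<in> P \<Longrightarrow> a + b \<in> P"
    and mult_P: "a \<in> C \<Longrightarrow> b \<in> P \<Longrightarrow> a * b \<in> P"
begin

lemma diff_C: "a \<in> C \<Longrightarrow> b \<in> C \<Longrightarrow> a - b \<in> C"
  using add_C[of a "- b"] uminus_C by simp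

lemma zero_C: "0 \<in> C"
  using P_subset zero_P by blast

lemma power_C: "a \<in> C \<Longrightarrow> a ^ n \<in> C"
  by (induction n) (auto intro: one_C mult_C)

lemma of_nat_C: "of_nat n \<in> C"
  by (induction n) (auto intro: one_C add_C zero_C)

lemma sum_C: "(\<And>i. i \<in> A \<Longrightarrow> f i \<in> C) \<Longrightarrow> sum f A \<in> C"
  by (induction A rule: infinite_finite_induct) (auto intro: add_C zero_C)

lemmas C_intros = one_C add_C mult_C uminus_C diff_C zero_C power_C of_nat_C sum_C

lemma uminus_P: "a \<in> P \<Longrightarrow> - a \<in> P"
  using mult_P[of "- 1" a] one_C uminus_C by simp

lemma diff_P: "a \<in> P \<Longrightarrow> b \<in> P \<Longrightarrow> a - b \<in> P"
  using add_P[of a "- b"] uminus_P by simp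

lemma mult_P': "b \<in> C \<Longrightarrow> a \<in> P \<Longrightarrow> a * b \<in> P"
  using mult_P[of b a] by (simp add: mult.commute)

lemma sum_P: "(\<And>i. i \<in> A \<Longrightarrow> f i \<in> P) \<Longrightarrow> sum f A \<in> P"
  by (induction A rule: infinite_finite_induct) (auto intro: add_P zero_P)

end

locale prime_of_subring = ideal_of_subring +
  assumes one_P: "1 \<notin> P"
    and prime: "a \<in> C \<Longrightarrow> b \<in> C \<Longrightarrow> a * b \<in> P \<Longrightarrow> a \<in> P \<or> b \<in> P"
begin

lemma power_P: "a \<in> C \<Longrightarrow> a ^ n \<in> P \<Longrightarrow> a \<in> P"
  by (induction n) (use one_P prime power_C in auto)

text \<open>Multiplying by \<open>z 0 ^ n\<close> clears the denominators of \<open>z k = z 0 * (t / z 0) ^ k\<close>.\<close>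

lemma scroll_form_in_prime:
  assumes C: "\<And>k. k \<le> n \<Longrightarrow> z k \<in> C" "t \<in> C" "a \<in> C" "b \<in> C"
    and geom: "\<And>k. k < n \<Longrightarrow> z 0 * z (Suc k) - t * z k \<in> P"
    and z0: "z 0 \<notin> P" and F: "scroll_form z a b n \<in> P"
  shows "z 0 * a - t * b \<in> P"
proof -
  have zC: "z 0 \<in> C" using C(1) by simp
  have pow: "z 0 ^ k * z k - z 0 * t ^ k \<in> P" if "k \<le> n" for k
    using that
  proof (induction k)
    case 0
    then show ?case by (simp add: zero_P)
  next
    case (Suc k)
    have "z 0 ^ k * (z 0 * z (Suc k) - t * z k) + t * (z 0 ^ k * z k - z 0 * t ^ k) \<in> P"
      using Suc by (intro add_P mult_P geom) (auto intro: power_C C zC)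
    then show ?case by (simp add: algebra_simps)
  qed
  let ?c = "\<lambda>k. (-1) ^ k * of_nat (n choose k) * (z 0 * a) ^ (n - k) * b ^ k"
  \<comment> \<open>The factor \<open>z 0 ^ n\<close> is split: \<open>z 0 ^ (n - k)\<close> is
    absorbed by the power of \<open>a\<close> and \<open>z 0 ^ k\<close> by \<open>z k\<close>, so
    that both sums have the coefficients \<open>?c k\<close>.\<close>
  have "z 0 ^ n * scroll_form z a b n - z 0 * (z 0 * a - t * b) ^ n
      = (\<Sum>k = 0..n. ?c k * (z 0 ^ k * z k - z 0 * t ^ k))"
  proof -
    have "z 0 ^ n * scroll_form z a b n = (\<Sum>k = 0..n. ?c k * (z 0 ^ k * z k))"
      unfolding scroll_form_def sum_distrib_left
    proof (rule sum.cong)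
      fix k assume "k \<in> {0..n}"
      then have "z 0 ^ n = z 0 ^ (n - k) * z 0 ^ k"
        by (simp flip: power_add)
      then show "z 0 ^ n * ((-1) ^ k * of_nat (n choose k) * a ^ (n - k) * z k * b ^ k)
          = ?c k * (z 0 ^ k * z k)"
        by (simp add: power_mult_distrib ac_simps)
    qed simp
    moreover have "z 0 * (z 0 * a - t * b) ^ n = (\<Sum>k = 0..n. ?c k * (z 0 * t ^ k))"
      unfolding binomial_diff[symmetric] sum_distrib_left
      by (rule sum.cong) (simp_all add: power_mult_distrib ac_simps)
    ultimately show ?thesis
      by (simp add: sum_subtractf right_diff_distrib)
  qed
  also have "\<dots> \<in> P"
    by (intro sum_P mult_P pow) (auto intro!: C_intros C zC)
  finally have "z 0 ^ n * scroll_form z a b n - (z 0 ^ n * scroll_form z a b n - z 0 * (z 0 * a - t * b) ^ n) \<in> P"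
    by (rule diff_P[OF mult_P[OF power_C[OF zC] F]])
  then have "z 0 * (z 0 * a - t * b) ^ n \<in> P"
    by simp
  moreover have "z 0 * a - t * b \<in> C"
    by (intro C_intros C zC)
  ultimately show ?thesis
    using prime[OF zC power_C] z0 power_P by blast
qed

text \<open>Every term before the last has a factor \<open>z k\<close> in \<open>P\<close>, and the
  binomial coefficient of the last term is 1.\<close>

lemma scroll_form_last_in_prime:
  assumes C: "z n \<in> C" "a \<in> C" "b \<in> C"
    and z: "\<And>k. k < n \<Longrightarrow> z k \<in> P" and F: "scroll_form z a b n \<in> P"
  shows "z n * b ^ n \<in> P"
proof -
  let ?f = "\<lambda>k. (-1) ^ k * of_nat (n choose k) * a ^ (n - k) * z k * b ^ k"
  have "sum ?f {0..<n} \<in> P"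
    by (intro sum_P mult_P mult_P' z) (auto intro!: C_intros C)
  moreover have "scroll_form z a b n = sum ?f {0..<n} + ?f n"
    unfolding scroll_form_def by (simp flip: atLeastLessThanSuc_atLeastAtMost)
  ultimately have "?f n \<in> P"
    using diff_P[OF F] by fastforce
  then have "(-1) ^ n * ?f n \<in> P"
    by (rule mult_P[rotated]) (intro C_intros)
  moreover have "(-1) ^ n * ?f n = z n * b ^ n"
    by (simp add: mult.assoc[symmetric] flip: power_add)
  ultimately show ?thesis by simp
qed

text \<open>The form of index \<open>k\<close> involves \<open>z (k + 1)\<close> and otherwise only
  \<open>z 0\<close>, ..., \<open>z k\<close>, which drives both inductions. If \<open>z 0\<close>
  is outside \<open>P\<close>, it yields the next proportion; if \<open>z 0\<close> is in
  \<open>P\<close>, it reduces to a power of \<open>z k\<close> up to sign. There is no form of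
  index \<open>n\<close>, hence no claim about \<open>z n\<close> in the second case.\<close>

lemma rational_normal_curve:
  assumes C: "\<And>k. k \<le> n \<Longrightarrow> z k \<in> C"
    and G: "\<And>i. 1 \<le> i \<Longrightarrow> i < n \<Longrightarrow> scroll_form z (z (i + 1)) (z i) i \<in> P"
  shows "z 0 \<notin> P \<Longrightarrow> k < n \<Longrightarrow> z 0 * z (Suc k) - z 1 * z k \<in> P"
    and "z 0 \<in> P \<Longrightarrow> k < n \<Longrightarrow> z k \<in> P"
proof -
  show "z 0 * z (Suc k) - z 1 * z k \<in> P" if "z 0 \<notin> P" "k < n"
    using that(2)
  proof (induction k rule: less_induct)
    case (less k)
    show ?case
    proof (cases "k = 0")
      case True
      then show ?thesis by (simp add: zero_P mult.commute)
    next
      case False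
      have "z 0 * z (k + 1) - z 1 * z k \<in> P"
        using less False
        by (intro scroll_form_in_prime[OF _ _ _ _ _ that(1) G]) (auto intro: C)
      then show ?thesis by simp
    qed
  qed
  show "z k \<in> P" if "z 0 \<in> P" "k < n"
    using that(2)
  proof (induction k rule: less_induct)
    case (less k)
    show ?case
    proof (cases "k = 0")
      case False
      have "z k * z k ^ k \<in> P"
        using less False
        by (intro scroll_form_last_in_prime[OF _ _ _ _ G]) (auto intro: C)
      then have "z k ^ Suc k \<in> P" by simp
      then show ?thesis using power_P less C by (meson less_imp_le)
    qed (use that in simp)
  qed
qed

text \<open>The minors vanish modulo \<open>P\<close> once all columns are proportional to one with
  top entry outside \<open>P\<close>, or once the top row lies in \<open>P\<close>. The reference
  column starts with \<open>x 0\<close> if that is outside \<open>P\<close>, and otherwise with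
  \<open>y 0\<close> if that is; if both lie in \<open>P\<close>, so does the top row.\<close>

lemma scroll_minors_in_prime:
  assumes cd: "1 \<le> c" "1 \<le> d"
    and x: "\<And>k. k \<le> c \<Longrightarrow> x k \<in> C" and y: "\<And>k. k \<le> d \<Longrightarrow> y k \<in> C"
    and F: "\<And>i. 1 \<le> i \<Longrightarrow> i < c \<Longrightarrow> scroll_form x (x (i + 1)) (x i) i \<in> P"
    and Fc: "scroll_form x (y 1) (y 0) c \<in> P"
    and G: "\<And>i. 1 \<le> i \<Longrightarrow> i < d \<Longrightarrow> scroll_form y (y (i + 1)) (y i) i \<in> P"
    and H: "x 0 * y d - x 1 * y (d - 1) \<in> P"
    and pq: "(p, p') \<in> (\<lambda>i. (x i, x (Suc i))) ` {..<c} \<union> (\<lambda>i. (y i, y (Suc i))) ` {..<d}"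
    and rs: "(r, r') \<in> (\<lambda>i. (x i, x (Suc i))) ` {..<c} \<union> (\<lambda>i. (y i, y (Suc i))) ` {..<d}"
  shows "p * r' - r * p' \<in> P"
proof -
  let ?cols = "(\<lambda>i. (x i, x (Suc i))) ` {..<c} \<union> (\<lambda>i. (y i, y (Suc i))) ` {..<d}"
  have colC: "p \<in> C \<and> p' \<in> C" if "(p, p') \<in> ?cols" for p p'
    using that x y by auto
  have rank_one: "p * r' - r * p' \<in> P"
    if s: "s \<in> C" "t \<in> C" "s \<notin> P"
      and *: "\<And>q q'. (q, q') \<in> ?cols \<Longrightarrow> s * q' - t * q \<in> P" for s t
  proof -
    have pr: "p \<in> C" "p' \<in> C" "r \<in> C" "r' \<in> C"
      using colC[OF pq] colC[OF rs] by auto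
    \<comment> \<open>The terms with \<open>t\<close> cancel and leave \<open>s\<close> times the
      minor.\<close>
    have "p * (s * r' - t * r) - r * (s * p' - t * p) \<in> P"
      by (rule diff_P[OF mult_P[OF pr(1) *[OF rs]] mult_P[OF pr(3) *[OF pq]]])
    moreover have "p * (s * r' - t * r) - r * (s * p' - t * p) = s * (p * r' - r * p')"
      by (simp add: algebra_simps)
    ultimately show ?thesis
      using prime[OF s(1)] s(3) pr by (metis C_intros(3,5))
  qed
  have x01: "x 0 \<in> C" "x 1 \<in> C" and y01: "y 0 \<in> C" "y 1 \<in> C" and yd: "y d \<in> C" "y (d - 1) \<in> C"
    using cd x y by auto
  have ylow: "y k \<in> P" if "y 0 \<in> P" "k < d" for k
    using rational_normal_curve(2)[of d y k] y G that by auto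
  have xlow: "x k \<in> P" if "x 0 \<in> P" "k < c" for k
    using rational_normal_curve(2)[of c x k] x F that by auto
  have xgeom: "x 0 * x (Suc k) - x 1 * x k \<in> P" if "x 0 \<notin> P" "k < c" for k
    using rational_normal_curve(1)[of c x k] x F that by auto
  have ygeom: "y 0 * y (Suc k) - y 1 * y k \<in> P" if "y 0 \<notin> P" "k < d" for k
    using rational_normal_curve(1)[of d y k] y G that by auto
  show ?thesis
  proof (cases "x 0 \<in> P")
    case False
    have y1: "x 0 * y 1 - x 1 * y 0 \<in> P"
      using x x01 y01 xgeom[OF False] Fc False
      by (intro scroll_form_in_prime[of c x "x 1" "y 1" "y 0"]) auto
    have "x 0 * y (Suc k) - x 1 * y k \<in> P" if k: "k < d" for k
    proof (cases "y 0 \<in> P")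
      case True
      \<comment> \<open>With \<open>y (d - 1)\<close> in \<open>P\<close>, only the first product of
        \<open>H\<close> is left.\<close>
      have "x 0 * y d \<in> P"
        using add_P[OF H, of "x 1 * y (d - 1)"] mult_P[OF x01(2) ylow[OF True]] cd by simp
      then have "y d \<in> P"
        using prime[OF x01(1) yd(1)] False by blast
      then have "y j \<in> P" if "j \<le> d" for j
        using ylow[OF True, of j] that by (cases "j = d") auto
      then show ?thesis
        using k x01 by (intro diff_P mult_P) auto
    next
      case y0: False
      have kC: "y k \<in> C" "y (Suc k) \<in> C" using k y by auto
      \<comment> \<open>Eliminates \<open>y 1\<close>: the proportion with \<open>y 1\<close> over
        \<open>y 0\<close> becomes one with \<open>x 1\<close> over \<open>x 0\<close>, at the cost
        of a factor \<open>y 0\<close> that can be cancelled.\<close>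
      have "x 0 * (y 0 * y (Suc k) - y 1 * y k) + y k * (x 0 * y 1 - x 1 * y 0) \<in> P"
        using x01 kC ygeom[OF y0 k] y1 by (intro add_P mult_P)
      then have "y 0 * (x 0 * y (Suc k) - x 1 * y k) \<in> P"
        by (simp add: algebra_simps)
      then show ?thesis
        using prime[OF y01(1)] y0 x01 kC by (metis C_intros(3,5))
    qed
    then have "x 0 * q' - x 1 * q \<in> P" if "(q, q') \<in> ?cols" for q q'
      using that xgeom[OF False] by auto
    then show ?thesis
      using rank_one[OF x01 False] by blast
  next
    case x0: True
    have "x c * y 0 ^ c \<in> P"
      using x y01 xlow[OF x0] Fc by (intro scroll_form_last_in_prime) auto
    then have alt: "x c \<in> P \<or> y 0 \<in> P"
      using prime[OF x[of c] power_C[OF y01(1)]] power_P[OF y01(1)] by blast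
    show ?thesis
    proof (cases "y 0 \<in> P")
      case True
      have "q \<in> P" if "(q, q') \<in> ?cols" for q q'
        using that xlow[OF x0] ylow[OF True] by auto
      then show ?thesis
        using pq rs colC by (intro diff_P mult_P') blast+
    next
      case False
      then have "x j \<in> P" if "j \<le> c" for j
        using xlow[OF x0, of j] alt that by (cases "j = c") auto
      then have "y 0 * q' - y 1 * q \<in> P" if "(q, q') \<in> ?cols" for q q'
        using that ygeom[OF False] diff_P[OF mult_P[OF y01(1)] mult_P[OF y01(2)]] by auto
      then show ?thesis
        using rank_one[OF y01 False] by blast
    qed
  qed
qed

end

section \<open>Prime ideals of polynomial rings\<close>

lemma mpoly_ring_simps [simp]:
  "p \<otimes>\<^bsub>mpoly_ring V\<^esub> q = p * q" "p \<oplus>\<^bsub>mpoly_ring V\<^esub> q = p + q"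
  "\<one>\<^bsub>mpoly_ring V\<^esub> = 1" "\<zero>\<^bsub>mpoly_ring V\<^esub> = 0"
  by (simp_all add: mpoly_ring_def)

lemma mpoly_ring_pow [simp]: "p [^]\<^bsub>mpoly_ring V\<^esub> (n::nat) = p ^ n"
  by (induction n) (simp_all add: nat_pow_def mult.commute)

lemma in_carrier_mpoly_ring:
  "p \<in> carrier (mpoly_ring V) \<longleftrightarrow> (\<forall>m \<in> Poly_Mapping.keys p. Poly_Mapping.keys m \<subseteq> V)"
  by (simp add: mpoly_ring_def)

lemma uminus_in_carrier_mpoly_ring:
  "p \<in> carrier (mpoly_ring V) \<Longrightarrow> - p \<in> carrier (mpoly_ring V)"
  by (simp add: in_carrier_mpoly_ring in_keys_iff)

lemma single_in_carrier_mpoly_ring: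
  "Poly_Mapping.keys m \<subseteq> V \<Longrightarrow> Poly_Mapping.single m a \<in> carrier (mpoly_ring V)"
  by (simp add: in_carrier_mpoly_ring)

lemma indet_in_carrier: "i \<in> V \<Longrightarrow> indet i \<in> carrier (mpoly_ring V)"
  unfolding indet_def by (rule single_in_carrier_mpoly_ring) simp

lemma ideal_mpoly_ringI:
  fixes I :: "'k::comm_ring_1 mpoly set"
  assumes sub: "I \<subseteq> carrier (mpoly_ring V)" and zero: "0 \<in> I"
    and add: "\<And>p q. p \<in> I \<Longrightarrow> q \<in> I \<Longrightarrow> p + q \<in> I"
    and mult: "\<And>p q. p \<in> carrier (mpoly_ring V) \<Longrightarrow> q \<in> I \<Longrightarrow> p * q \<in> I"
  shows "ideal I (mpoly_ring V)"
proof -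
  interpret R: cring "mpoly_ring V :: 'k mpoly ring" by (rule cring_mpoly_ring)
  have inv: "\<ominus>\<^bsub>mpoly_ring V\<^esub> p = - p" if p: "p \<in> carrier (mpoly_ring V)" for p :: "'k mpoly"
    using R.minus_equality[of "- p" p] p uminus_in_carrier_mpoly_ring[OF p]
    by simp
  have uminus: "- p \<in> I" if "p \<in> I" for p
    using mult[OF uminus_in_carrier_mpoly_ring[OF R.one_closed] that] by simp
  show ?thesis
  proof (rule idealI)
    show "subgroup I (add_monoid (mpoly_ring V))"
      using sub zero add uminus inv by (intro R.add.subgroupI) (auto simp: subset_iff)
  next
    show "ring (mpoly_ring V :: 'k mpoly ring)" by (rule R.ring_axioms)
  next
    fix p q :: "'k mpoly" assume "p \<in> I" "q \<in> carrier (mpoly_ring V)"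
    then show "q \<otimes>\<^bsub>mpoly_ring V\<^esub> p \<in> I" "p \<otimes>\<^bsub>mpoly_ring V\<^esub> q \<in> I"
      using mult[of q p] by (simp_all add: mult.commute)
  qed
qed

lemma ideal_of_subring_mpoly_ring:
  fixes I :: "'k::comm_ring_1 mpoly set"
  assumes "ideal I (mpoly_ring V)"
  shows "ideal_of_subring (carrier (mpoly_ring V)) I"
proof -
  interpret R: cring "mpoly_ring V :: 'k mpoly ring" by (rule cring_mpoly_ring)
  interpret I: ideal I "mpoly_ring V :: 'k mpoly ring" by (rule assms)
  show ?thesis
    using R.one_closed R.a_closed R.m_closed uminus_in_carrier_mpoly_ring
      I.Icarr I.zero_closed I.a_closed I.I_l_closed
    by unfold_locales (simp_all add: I.a_subset)
qed

lemma prime_of_subring_mpoly_ring: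
  fixes I :: "'k::comm_ring_1 mpoly set"
  assumes "primeideal I (mpoly_ring V)"
  shows "prime_of_subring (carrier (mpoly_ring V)) I"
proof -
  interpret primeideal I "mpoly_ring V :: 'k mpoly ring" by (rule assms)
  interpret I: ideal_of_subring "carrier (mpoly_ring V)" I
    by (rule ideal_of_subring_mpoly_ring) (rule is_ideal)
  show ?thesis
    by unfold_locales (use I_notcarr one_imp_carrier I_prime in auto)
qed

text \<open>The kernel of a homomorphism into a domain: with coefficients in an integral domain and
  exponents in a linearly ordered cancellative monoid there are no zero divisors. This is why
  \<open>'b\<close> carries an order.\<close>

lemma primeideal_push_kernel:
  fixes w :: "(nat \<Rightarrow>\<^sub>0 nat) \<Rightarrow> 'b::{ordered_cancel_comm_monoid_add, linorder}"
  assumes "monomial_map w"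
  shows "primeideal {p \<in> carrier (mpoly_ring V). push w p = (0 :: 'b \<Rightarrow>\<^sub>0 'k::idom)} (mpoly_ring V)"
proof -
  interpret w: monomial_map w by (rule assms)
  interpret R: cring "mpoly_ring V :: 'k mpoly ring" by (rule cring_mpoly_ring)
  let ?Q = "{p \<in> carrier (mpoly_ring V). push w p = (0 :: 'b \<Rightarrow>\<^sub>0 'k)}"
  show ?thesis
  proof (rule primeidealI)
    show "ideal ?Q (mpoly_ring V)"
      using R.zero_closed R.a_closed R.m_closed
      by (intro ideal_mpoly_ringI) (auto simp: w.push_hom)
    have "(1 :: 'k mpoly) \<notin> ?Q" by (simp add: w.push_one)
    then show "carrier (mpoly_ring V) \<noteq> ?Q"
      using R.one_closed by auto
  qed (auto simp: w.push_times R.is_cring)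
qed

section \<open>Substituting monomials for indeterminates\<close>

text \<open>The effect on exponents of replacing indeterminate \<open>i\<close> by the monomial with
  exponent \<open>g i\<close>. The product with \<open>of_nat\<close> is taken in the convolution
  semiring, where it is an iterated sum of \<open>g i\<close>.\<close>

definition lin_ext :: "('a \<Rightarrow> 'b \<Rightarrow>\<^sub>0 nat) \<Rightarrow> ('a \<Rightarrow>\<^sub>0 nat) \<Rightarrow> ('b::comm_monoid_add \<Rightarrow>\<^sub>0 nat)" where
  "lin_ext g m = (\<Sum>i\<in>Poly_Mapping.keys m. of_nat (Poly_Mapping.lookup m i) * g i)"

lemma lin_ext_superset:
  assumes "finite A" "Poly_Mapping.keys m \<subseteq> A"
  shows "lin_ext g m = (\<Sum>i\<in>A. of_nat (Poly_Mapping.lookup m i) * g i)"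
  unfolding lin_ext_def by (rule sum.mono_neutral_left) (use assms in \<open>auto simp: in_keys_iff\<close>)

lemma monomial_map_lin_ext: "monomial_map (lin_ext g)"
proof
  fix m n :: "'a \<Rightarrow>\<^sub>0 nat"
  let ?A = "Poly_Mapping.keys m \<union> Poly_Mapping.keys n"
  have "lin_ext g l = (\<Sum>i\<in>?A. of_nat (Poly_Mapping.lookup l i) * g i)"
    if "Poly_Mapping.keys l \<subseteq> ?A" for l
    by (rule lin_ext_superset) (use that in auto)
  from this[of "m + n"] this[of m] this[of n] show "lin_ext g (m + n) = lin_ext g m + lin_ext g n"
    using Poly_Mapping.keys_add[of m n] by (simp add: lookup_add distrib_right sum.distrib)
qed (simp add: lin_ext_def)

lemma lin_ext_single: "lin_ext g (Poly_Mapping.single i n) = of_nat n * g i"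
  by (simp add: lin_ext_def)

lemma lookup_of_nat_mult:
  "Poly_Mapping.lookup (of_nat n * p :: 'b::comm_monoid_add \<Rightarrow>\<^sub>0 nat) k = n * Poly_Mapping.lookup p k"
  by (induction n) (simp_all add: lookup_add distrib_right)

lemma lookup_lin_ext:
  "Poly_Mapping.lookup (lin_ext g m) k =
    (\<Sum>i\<in>Poly_Mapping.keys m. Poly_Mapping.lookup m i * Poly_Mapping.lookup (g i) k)"
  by (simp add: lin_ext_def lookup_sum lookup_of_nat_mult)

lemma lin_ext_lin_ext: "lin_ext h (lin_ext g m) = lin_ext (\<lambda>i. lin_ext h (g i)) m"
proof -
  interpret h: monomial_map "lin_ext h" by (rule monomial_map_lin_ext)
  have scale: "lin_ext h (of_nat n * p) = of_nat n * lin_ext h p" for n p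
    by (induction n) (simp_all add: h.zero h.add distrib_right)
  have "lin_ext h (\<Sum>i\<in>A. f i) = (\<Sum>i\<in>A. lin_ext h (f i))" for A and f :: "'c \<Rightarrow> _"
    by (induction A rule: infinite_finite_induct) (simp_all add: h.zero h.add)
  from this[of "\<lambda>i. of_nat (Poly_Mapping.lookup m i) * g i" "Poly_Mapping.keys m"] show ?thesis
    by (simp add: scale flip: lin_ext_def)
qed

lemma indet_power: "indet i ^ n = Poly_Mapping.single (Poly_Mapping.single i n) 1"
  by (induction n) (simp_all add: indet_def mult_single flip: single_add)

lemma poly_mapping_split_key:
  assumes "i \<in> Poly_Mapping.keys (m :: 'a \<Rightarrow>\<^sub>0 nat)"
  obtains m' where "m = Poly_Mapping.single i 1 + m'" "Poly_Mapping.keys m' \<subseteq> Poly_Mapping.keys m"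
proof
  have eq: "m = Poly_Mapping.single i 1 + (m - Poly_Mapping.single i 1)"
    using assms by (intro poly_mapping_eqI) (auto simp: lookup_add lookup_minus lookup_single when_def in_keys_iff)
  then show "m = Poly_Mapping.single i 1 + (m - Poly_Mapping.single i 1)" .
  show "Poly_Mapping.keys (m - Poly_Mapping.single i 1) \<subseteq> Poly_Mapping.keys m"
    by (auto simp: in_keys_iff lookup_minus)
qed

section \<open>The two-minors of the scroll matrix\<close>

lemma det_2x2:
  assumes "A \<in> carrier_mat 2 2"
  shows "det A = A $$ (0, 0) * A $$ (1, 1) - A $$ (0, 1) * A $$ (1, 0)"
proof -
  have 2: "{..<2::nat} = {0, 1}" by auto
  have "det (mat_delete A 0 0) = A $$ (1, 1)" "det (mat_delete A 0 1) = A $$ (1, 0)"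
    by (subst det_single; use assms in \<open>simp add: mat_delete_def\<close>)+
  then show ?thesis
    using laplace_expansion_row[OF assms, of 0] by (simp add: 2 cofactor_def)
qed


lemma minor_2:
  assumes A: "dim_row A = 2" and ab: "a < b" "b < dim_col A"
  shows "det (submatrix A {0, 1} {a, b}) = A $$ (0, a) * A $$ (1, b) - A $$ (0, b) * A $$ (1, a)"
proof -
  have [simp]: "{j. j < dim_col A \<and> (j = a \<or> j = b)} = {a, b}" "{i::nat. i < 2 \<and> (i = 0 \<or> i = Suc 0)} = {0, 1}"
    using ab by auto
  \<comment> \<open>\<open>submatrix\<close> enumerates the selected rows and columns by successive
    least elements; these are the values of that enumeration.\<close>
  have least: "(LEAST j. j = a \<or> j = b) = a" "(LEAST j. (j = a \<or> j = b) \<and> a < j) = b"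
    "(LEAST j::nat. j = 0 \<or> j = Suc 0) = 0" "(LEAST j. (j = 0 \<or> j = Suc 0) \<and> 0 < j) = Suc 0"
    using ab by (auto intro!: Least_equality)
  have "submatrix A {0, 1} {a, b} \<in> carrier_mat 2 2"
    using A ab by (auto simp: submatrix_def)
  from det_2x2[OF this] show ?thesis
    using A ab by (simp add: submatrix_def least mult.commute)
qed

lemma minors_2:
  assumes A: "dim_row A = 2"
  shows "minors 2 A =
    {A $$ (0, a) * A $$ (1, b) - A $$ (0, b) * A $$ (1, a) | a b. a < b \<and> b < dim_col A}"
proof (intro equalityI subsetI)
  fix p assume "p \<in> minors 2 A"
  then obtain S T where p: "p = det (submatrix A S T)"
    and S: "S \<subseteq> {..<2}" "card S = 2" and T: "T \<subseteq> {..<dim_col A}" "card T = 2"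
    using A by (auto simp: minors_def)
  have "S = {..<2}"
    using S by (intro card_subset_eq) auto
  then have S01: "S = {0, 1}" by auto
  obtain a b where "T = {a, b}" "a \<noteq> b" using T(2) by (auto simp: card_2_iff)
  then obtain a b where ab: "T = {a, b}" "a < b"
    by (metis insert_commute linorder_neqE_nat)
  then have "b < dim_col A" using T by auto
  then show "p \<in> {A $$ (0, a) * A $$ (1, b) - A $$ (0, b) * A $$ (1, a) | a b. a < b \<and> b < dim_col A}"
    using minor_2[OF A ab(2)] p S01 ab by blast
next
  fix p assume "p \<in> {A $$ (0, a) * A $$ (1, b) - A $$ (0, b) * A $$ (1, a) | a b. a < b \<and> b < dim_col A}"
  then obtain a b where ab: "a < b" "b < dim_col A"
    and "p = A $$ (0, a) * A $$ (1, b) - A $$ (0, b) * A $$ (1, a)" by blast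
  then have "p = det (submatrix A {0, 1} {a, b})"
    using minor_2[OF A ab] by simp
  moreover have "{0, 1} \<subseteq> {..<dim_row A}" "card {0, 1::nat} = 2" "card {a, b} = 2" "{a, b} \<subseteq> {..<dim_col A}"
    using A ab by auto
  ultimately show "p \<in> minors 2 A" unfolding minors_def by blast
qed

definition scroll_minor :: "nat \<Rightarrow> nat \<Rightarrow> 'k::comm_ring_1 mpoly" where
  "scroll_minor i j = indet i * indet (Suc j) - indet j * indet (Suc i)"

text \<open>Naming a column by the index of its top entry treats both blocks alike, since the entry
  below has the next index. Among 0, ..., c + d only \<open>c\<close> is not a top index: x_c is
  followed by y_0 in the numbering.\<close>

lemma minors_A_mat:
  "minors 2 (A_mat c d :: 'k::comm_ring_1 mpoly mat) =
    {scroll_minor i j | i j. i < j \<and> j \<le> c + d \<and> i \<noteq> c \<and> j \<noteq> c}"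
proof -
  let ?top = "\<lambda>a. if a < c then a else Suc a"
  have A: "A_mat c d $$ (r, a) = (indet (?top a + r) :: 'k mpoly)" if "r < 2" "a < c + d" for r a
    using that by (simp add: A_mat_def xvar_def yvar_def)
  have "minors 2 (A_mat c d :: 'k mpoly mat) =
    {A_mat c d $$ (0, a) * A_mat c d $$ (1, b) - A_mat c d $$ (0, b) * A_mat c d $$ (1, a)
      | a b. a < b \<and> b < c + d}"
    by (subst minors_2) (simp_all add: A_mat_def)
  also have "\<dots> = {scroll_minor (?top a) (?top b) | a b. a < b \<and> b < c + d}"
  proof -
    have cong: "{f a b | a b. Q a b} = {g a b | a b. Q a b}"
      if "\<And>a b. Q a b \<Longrightarrow> f a b = g a b" for f g :: "nat \<Rightarrow> nat \<Rightarrow> 'k mpoly" and Q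
      using that by metis
    have "A_mat c d $$ (0, a) * A_mat c d $$ (1, b) - A_mat c d $$ (0, b) * A_mat c d $$ (1, a)
        = (scroll_minor (?top a) (?top b) :: 'k mpoly)" if "a < b" "b < c + d" for a b
      using that by (simp add: A scroll_minor_def)
    then show ?thesis by (intro cong) simp
  qed
  also have "\<dots> = {scroll_minor i j | i j. i < j \<and> j \<le> c + d \<and> i \<noteq> c \<and> j \<noteq> c}"
  proof (intro equalityI subsetI)
    fix p :: "'k mpoly" assume "p \<in> {scroll_minor (?top a) (?top b) | a b. a < b \<and> b < c + d}"
    then obtain a b where "p = scroll_minor (?top a) (?top b)" "a < b" "b < c + d" by blast
    moreover from this have "?top a < ?top b" "?top b \<le> c + d" "?top a \<noteq> c" "?top b \<noteq> c" by auto
    ultimately show "p \<in> {scroll_minor i j | i j. i < j \<and> j \<le> c + d \<and> i \<noteq> c \<and> j \<noteq> c}" by blast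
  next
    fix p :: "'k mpoly" assume "p \<in> {scroll_minor i j | i j. i < j \<and> j \<le> c + d \<and> i \<noteq> c \<and> j \<noteq> c}"
    then obtain i j where p: "p = scroll_minor i j" and ij: "i < j" "j \<le> c + d" "i \<noteq> c" "j \<noteq> c" by blast
    let ?col = "\<lambda>i. if i < c then i else i - 1"
    have "?top (?col i) = i" "?top (?col j) = j" "?col i < ?col j" "?col j < c + d"
      using ij by auto
    then show "p \<in> {scroll_minor (?top a) (?top b) | a b. a < b \<and> b < c + d}"
      using p by (intro CollectI exI[of _ "?col i"] exI[of _ "?col j"]) (simp only:)
  qed
  finally show ?thesis .
qed

section \<open>Parametrizing the scroll\<close>

text \<open>Index of the first indeterminate in the block of \<open>i\<close>; the offset of
  \<open>i\<close> from it is the exponent of \<open>t\<close> in the parametrization.\<close>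

definition row_start :: "nat \<Rightarrow> nat \<Rightarrow> nat" where
  "row_start c i = (if i \<le> c then 0 else Suc c)"

text \<open>The indeterminates with index in \<open>S\<close> are specialized to the scroll
  \<open>x\<^sub>i = u t\<^sup>i\<close>, \<open>y\<^sub>j = v t\<^sup>j\<close>, where \<open>u\<close>, \<open>v\<close>, \<open>t\<close> are the indeterminates with
  indices \<open>0\<close>, \<open>c + 1\<close>, \<open>c + d + 2\<close>.\<close>

definition scroll_exp :: "nat \<Rightarrow> nat \<Rightarrow> nat set \<Rightarrow> nat \<Rightarrow> (nat \<Rightarrow>\<^sub>0 nat)" where
  "scroll_exp c d S i =
    (if i \<in> S then Poly_Mapping.single (row_start c i) 1
       + Poly_Mapping.single (c + d + 2) (i - row_start c i)
     else Poly_Mapping.single i 1)"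

abbreviation scroll_map :: "nat \<Rightarrow> nat \<Rightarrow> nat set \<Rightarrow> (nat \<Rightarrow>\<^sub>0 nat) \<Rightarrow> (nat \<Rightarrow>\<^sub>0 nat)" where
  "scroll_map c d S \<equiv> lin_ext (scroll_exp c d S)"

section \<open>Kernels of partial specializations\<close>

definition scroll_kernel :: "nat \<Rightarrow> nat \<Rightarrow> nat set \<Rightarrow> 'k::comm_ring_1 mpoly set" where
  "scroll_kernel c d S = {p \<in> carrier (R_ring c d). push (scroll_map c d S) p = 0}"

lemma primeideal_scroll_kernel:
  "primeideal (scroll_kernel c d S :: 'k::idom mpoly set) (R_ring c d)"
  unfolding scroll_kernel_def R_ring_def
  by (rule primeideal_push_kernel) (rule monomial_map_lin_ext)

text \<open>The smaller specialization produces only \<open>t\<close>, the first indeterminates of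
  the blocks, and indeterminates it leaves alone. The larger one fixes the first two kinds and
  treats the third as it would have done directly.\<close>

lemma scroll_map_compose:
  assumes "S \<subseteq> S'" "S' \<subseteq> {..<c + d + 2}"
  shows "scroll_map c d S' \<circ> scroll_map c d S = scroll_map c d S'"
proof
  interpret monomial_map "scroll_map c d S'" by (rule monomial_map_lin_ext)
  have T: "c + d + 2 \<notin> S'" using assms by auto
  have "scroll_map c d S' (scroll_exp c d S i) = scroll_exp c d S' i" for i
  proof (cases "i \<in> S")
    case True
    then have i: "i \<in> S'" using assms by blast
    have "scroll_map c d S' (scroll_exp c d S i)
        = scroll_exp c d S' (row_start c i) + of_nat (i - row_start c i) * Poly_Mapping.single (c + d + 2) 1"
      using True T by (simp add: scroll_exp_def[of c d S] add lin_ext_single)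
        (simp add: scroll_exp_def)
    also have "scroll_exp c d S' (row_start c i) = Poly_Mapping.single (row_start c i) 1"
      by (simp add: scroll_exp_def row_start_def)
    also have "of_nat (i - row_start c i) * Poly_Mapping.single (c + d + 2) 1
        = Poly_Mapping.single (c + d + 2) (i - row_start c i)"
      by (intro poly_mapping_eqI) (simp add: lookup_of_nat_mult lookup_single when_def)
    finally show ?thesis using i by (simp add: scroll_exp_def[of c d S' i])
  next
    case False
    then show ?thesis by (simp add: scroll_exp_def[of c d S] lin_ext_single)
  qed
  then show "(scroll_map c d S' \<circ> scroll_map c d S) m = scroll_map c d S' m" for m
    by (simp add: lin_ext_lin_ext)
qed

lemma scroll_kernel_mono:
  assumes "S \<subseteq> S'" "S' \<subseteq> {..<c + d + 2}"
  shows "scroll_kernel c d S \<subseteq> scroll_kernel c d S'"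
proof
  fix p :: "'k::comm_ring_1 mpoly" assume p: "p \<in> scroll_kernel c d S"
  have "push (scroll_map c d S') p = push (scroll_map c d S') (push (scroll_map c d S) p)"
    by (simp add: push_push scroll_map_compose[OF assms])
  with p show "p \<in> scroll_kernel c d S'" by (simp add: scroll_kernel_def)
qed

lemma push_scroll_indet:
  "push (scroll_map c d S) (indet i :: 'k::comm_ring_1 mpoly) =
    (if i \<in> S then indet (row_start c i) * indet (c + d + 2) ^ (i - row_start c i) else indet i)"
  unfolding indet_power by (simp add: indet_def lin_ext_single scroll_exp_def mult_single)

lemma scroll_kernel_strict_mono:
  assumes S: "S \<subseteq> S'" "S' \<subseteq> {..<c + d + 2}" and one: "1 \<in> S" "1 \<le> c"
    and j: "j \<in> S'" "j \<notin> S" "j \<noteq> row_start c j"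
  shows "(scroll_kernel c d S :: 'k::idom mpoly set) \<subset> scroll_kernel c d S'"
proof
  show "(scroll_kernel c d S :: 'k mpoly set) \<subseteq> scroll_kernel c d S'"
    by (rule scroll_kernel_mono) fact+
  let ?n = "j - row_start c j" and ?b = "row_start c j"
  \<comment> \<open>The equation z_j = t^n z_b with t = x_1/x_0, cleared of denominators.
    Specializing \<open>j\<close> kills it; as long as \<open>j\<close> is untouched, the image is
    x_0^n (z_j - t^n z_b).\<close>
  let ?f = "indet 0 ^ ?n * indet j - indet 1 ^ ?n * indet ?b :: 'k mpoly"
  interpret monomial_map "scroll_map c d X" for X by (rule monomial_map_lin_ext)
  interpret I: ideal_of_subring "carrier (R_ring c d)" "{0 :: 'k mpoly}"
    unfolding R_ring_def by (rule ideal_of_subring_mpoly_ring)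
      (use ring.zeroideal[OF cring.axioms(1)[OF cring_mpoly_ring[of "{..<c + d + 2}"]]] in simp)
  have f: "?f \<in> carrier (R_ring c d)"
    using S j one by (intro I.C_intros; unfold R_ring_def; intro indet_in_carrier)
      (auto simp: row_start_def)
  have 0: "push (scroll_map c d X) (indet 0 :: 'k mpoly) = indet 0"
    and b: "push (scroll_map c d X) (indet ?b :: 'k mpoly) = indet ?b" for X
    by (auto simp: push_scroll_indet row_start_def)
  have 1: "push (scroll_map c d X) (indet 1 :: 'k mpoly) = indet 0 * indet (c + d + 2)" if "1 \<in> X" for X
    using that one by (simp add: push_scroll_indet row_start_def)
  have "push (scroll_map c d S') ?f = 0"
    using one S j by (simp only: push_hom 0 b 1[OF subsetD[OF S(1)]])
      (simp add: push_scroll_indet power_mult_distrib ac_simps)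
  then have mem: "?f \<in> scroll_kernel c d S'"
    using f by (simp add: scroll_kernel_def)
  have "push (scroll_map c d S) ?f = indet 0 ^ ?n * (indet j - indet (c + d + 2) ^ ?n * indet ?b)"
    using one j by (simp only: push_hom 0 b 1)
      (simp add: push_scroll_indet power_mult_distrib algebra_simps)
  moreover have "indet 0 ^ ?n \<noteq> (0 :: 'k mpoly)"
    by (metis indet_power lookup_single_eq lookup_zero zero_neq_one)
  moreover have "indet j - indet (c + d + 2) ^ ?n * indet ?b \<noteq> (0 :: 'k mpoly)"
  proof -
    \<comment> \<open>Neither \<open>t\<close> nor the first indeterminate of the block is z_j, so
      the second monomial cannot cancel the first.\<close>
    have "j \<noteq> c + d + 2" using S j by auto
    then have "Poly_Mapping.lookup (Poly_Mapping.single (c + d + 2) ?n + Poly_Mapping.single ?b 1) j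
        \<noteq> Poly_Mapping.lookup (Poly_Mapping.single j (1::nat)) j"
      using j by (simp add: lookup_add lookup_single when_def)
    then have "Poly_Mapping.single (c + d + 2) ?n + Poly_Mapping.single ?b 1 \<noteq> Poly_Mapping.single j 1"
      by metis
    then have "Poly_Mapping.lookup (indet j - indet (c + d + 2) ^ ?n * indet ?b :: 'k mpoly)
        (Poly_Mapping.single j 1) = 1"
      unfolding indet_power by (simp add: indet_def mult_single lookup_minus lookup_single when_def)
    then show ?thesis by auto
  qed
  ultimately have "?f \<notin> scroll_kernel c d S"
    by (simp add: scroll_kernel_def)
  with mem show "scroll_kernel c d S \<noteq> (scroll_kernel c d S' :: 'k mpoly set)"
    by blast
qed

text \<open>Starting with indices 0 and 1 specialized, the indices 2, ..., c and c + 2, ..., c + d +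
  1 are added singly, which makes (c - 1) + d inclusions.\<close>

lemma scroll_kernel_chain:
  assumes "2 \<le> c" "1 \<le> d"
  shows "\<exists>Q :: nat \<Rightarrow> 'k::idom mpoly set.
    (\<forall>i\<le>c + d - 1. primeideal (Q i) (R_ring c d)) \<and> (\<forall>i<c + d - 1. Q i \<subset> Q (Suc i))
    \<and> Q (c + d - 1) = scroll_kernel c d {..<c + d + 2}"
proof -
  text \<open>The index \<open>c + 1\<close> is skipped, since specializing \<open>y\<^sub>0\<close> to \<open>v\<close> imposes no condition.\<close>
  define s where "s k = (if k < c then {..k + 1} else {..k + 2})" for k
  have "(scroll_kernel c d (s k) :: 'k mpoly set) \<subset> scroll_kernel c d (s (Suc k))" if "k < c + d - 1" for k
  proof (rule scroll_kernel_strict_mono)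
    let ?j = "if Suc k < c then k + 2 else k + 3"
    show "?j \<in> s (Suc k)" "?j \<notin> s k" "?j \<noteq> row_start c ?j"
      by (auto simp: s_def row_start_def)
  qed (use that assms in \<open>auto simp: s_def\<close>)
  moreover have "s (c + d - 1) = {..<c + d + 2}"
    using assms by (auto simp: s_def)
  ultimately show ?thesis
    by (intro exI[of _ "\<lambda>k. scroll_kernel c d (s k)"]) (simp add: primeideal_scroll_kernel)
qed

section \<open>The toric ideal is generated by the minors\<close>

lemma cring_R_ring: "cring (R_ring c d :: 'k::comm_ring_1 mpoly ring)"
  unfolding R_ring_def by (rule cring_mpoly_ring)

lemma single_in_R_ring:
  "Poly_Mapping.keys m \<subseteq> {..<c + d + 2} \<Longrightarrow> Poly_Mapping.single m a \<in> carrier (R_ring c d)"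
  unfolding R_ring_def by (rule single_in_carrier_mpoly_ring)

lemma indet_in_R_ring: "i < c + d + 2 \<Longrightarrow> indet i \<in> carrier (R_ring c d)"
  unfolding R_ring_def by (rule indet_in_carrier) simp

lemma ideal_of_subring_R_ring:
  "ideal I (R_ring c d) \<Longrightarrow> ideal_of_subring (carrier (R_ring c d)) (I :: 'k::comm_ring_1 mpoly set)"
  unfolding R_ring_def by (rule ideal_of_subring_mpoly_ring)

lemma prime_of_subring_R_ring:
  "primeideal I (R_ring c d) \<Longrightarrow> prime_of_subring (carrier (R_ring c d)) (I :: 'k::comm_ring_1 mpoly set)"
  unfolding R_ring_def by (rule prime_of_subring_mpoly_ring)

lemma scroll_minor_in_R_ring:
  assumes "i \<le> c + d" "j \<le> c + d"
  shows "scroll_minor i j \<in> carrier (R_ring c d :: 'k::comm_ring_1 mpoly ring)"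
proof -
  interpret ideal_of_subring "carrier (R_ring c d)" "carrier (R_ring c d) :: 'k mpoly set"
    by (intro ideal_of_subring_R_ring ring.oneideal cring.axioms cring_R_ring)
  show ?thesis
    unfolding scroll_minor_def by (intro C_intros indet_in_R_ring) (use assms in auto)
qed

lemma minors_subset_R_ring:
  "minors 2 (A_mat c d) \<subseteq> carrier (R_ring c d :: 'k::comm_ring_1 mpoly ring)"
  unfolding minors_A_mat by (auto intro!: scroll_minor_in_R_ring)

lemma ideal_I_ideal: "ideal (I_ideal c d :: 'k::comm_ring_1 mpoly set) (R_ring c d)"
  unfolding I_ideal_def
  by (rule ring.genideal_ideal[OF cring.axioms(1)[OF cring_R_ring] minors_subset_R_ring])

lemma scroll_minor_in_I_ideal:
  assumes "i \<le> c + d" "j \<le> c + d" "i \<noteq> c" "j \<noteq> c"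
  shows "scroll_minor i j \<in> (I_ideal c d :: 'k::comm_ring_1 mpoly set)"
proof -
  interpret ideal_of_subring "carrier (R_ring c d)" "I_ideal c d :: 'k mpoly set"
    by (rule ideal_of_subring_R_ring) (rule ideal_I_ideal)
  have less: "scroll_minor i j \<in> (I_ideal c d :: 'k mpoly set)"
    if "i < j" "j \<le> c + d" "i \<noteq> c" "j \<noteq> c" for i j
    using that ring.genideal_self[OF cring.axioms(1)[OF cring_R_ring] minors_subset_R_ring]
    unfolding I_ideal_def minors_A_mat by blast
  have "scroll_minor i j = - (scroll_minor j i :: 'k mpoly)"
    by (simp add: scroll_minor_def)
  moreover have "scroll_minor i i = (0 :: 'k mpoly)"
    by (simp add: scroll_minor_def)
  ultimately show ?thesis
    using less[of i j] less[of j i] assms uminus_P zero_P by (cases i j rule: linorder_cases) auto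
qed

declare add_2_eq_Suc [simp del] add_2_eq_Suc' [simp del]

context
  fixes c d :: nat
begin

private abbreviation "V \<equiv> {..<c + d + 2}"
private abbreviation "E \<equiv> scroll_exp c d V"
private abbreviation "W \<equiv> scroll_map c d V"
private abbreviation "t \<equiv> c + d + 2"

interpretation W: monomial_map W by (rule monomial_map_lin_ext)

text \<open>A step to the next index inside a block multiplies the image by \<open>t\<close>,
  whichever block it is. From \<open>c\<close> the step would lead into the other block.\<close>

lemma scroll_exp_exchange:
  assumes "i \<le> c + d" "j \<le> c + d" "i \<noteq> c" "j \<noteq> c"
  shows "E i + E (Suc j) = E (Suc i) + E j"
proof -
  have E: "E (Suc k) = E k + Poly_Mapping.single t 1" if "k \<le> c + d" "k \<noteq> c" for k
    using that by (auto simp: scroll_exp_def row_start_def add.assoc Suc_diff_le simp flip: single_add)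
  show ?thesis unfolding E[OF assms(1,3)] E[OF assms(2,4)] by (simp only: ac_simps)
qed

lemma scroll_minor_in_kernel:
  assumes "i \<le> c + d" "j \<le> c + d" "i \<noteq> c" "j \<noteq> c"
  shows "scroll_minor i j \<in> (scroll_kernel c d V :: 'k::comm_ring_1 mpoly set)"
proof -
  have "E j + E (Suc i) = E i + E (Suc j)"
    using scroll_exp_exchange[OF assms] by (simp add: ac_simps)
  then have "push W (scroll_minor i j :: 'k mpoly) = 0"
    by (simp add: scroll_minor_def indet_def mult_single push_diff W.add lin_ext_single)
  then show ?thesis
    using scroll_minor_in_R_ring[OF assms(1,2)] by (simp add: scroll_kernel_def)
qed

lemma I_ideal_subset_kernel: "I_ideal c d \<subseteq> (scroll_kernel c d V :: 'k::idom mpoly set)"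
  unfolding I_ideal_def
proof (rule ring.genideal_minimal[OF cring.axioms(1)[OF cring_R_ring]])
  show "ideal (scroll_kernel c d V :: 'k mpoly set) (R_ring c d)"
    by (rule primeideal.axioms(1)[OF primeideal_scroll_kernel])
  show "minors 2 (A_mat c d) \<subseteq> (scroll_kernel c d V :: 'k mpoly set)"
    unfolding minors_A_mat by (auto intro!: scroll_minor_in_kernel)
qed

lemma lookup_scroll_exp:
  assumes "i < t"
  shows "Poly_Mapping.lookup (E i) t = i - row_start c i"
    and "k < t \<Longrightarrow> Poly_Mapping.lookup (E i) k = (if k = row_start c i then 1 else 0)"
  using assms by (auto simp: scroll_exp_def lookup_add lookup_single when_def row_start_def)

private abbreviation (input) monom :: "(nat \<Rightarrow>\<^sub>0 nat) \<Rightarrow> 'k::comm_ring_1 mpoly" where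
  "monom m \<equiv> Poly_Mapping.single m 1"
private abbreviation (input) e :: "nat \<Rightarrow> nat \<Rightarrow>\<^sub>0 nat" where
  "e i \<equiv> Poly_Mapping.single i 1"

lemma W_e [simp]: "W (e i) = E i"
  by (simp add: lin_ext_single)

lemma exchange_in_I_ideal:
  assumes "i \<le> c + d" "j \<le> c + d" "i \<noteq> c" "j \<noteq> c" "Poly_Mapping.keys r \<subseteq> V"
  shows "monom (e i + (e (Suc j) + r)) - monom (e (Suc i) + (e j + r)) \<in> (I_ideal c d :: 'k::comm_ring_1 mpoly set)"
proof -
  interpret ideal_of_subring "carrier (R_ring c d)" "I_ideal c d :: 'k mpoly set"
    by (rule ideal_of_subring_R_ring) (rule ideal_I_ideal)
  have "monom r * scroll_minor i j \<in> (I_ideal c d :: 'k mpoly set)"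
    by (intro mult_P single_in_R_ring scroll_minor_in_I_ideal assms)
  moreover have "monom r * scroll_minor i j = (monom (e i + (e (Suc j) + r)) - monom (e (Suc i) + (e j + r)) :: 'k mpoly)"
    by (simp add: scroll_minor_def indet_def right_diff_distrib mult_single ac_simps)
  ultimately show ?thesis by simp
qed

text \<open>Makes a chosen indeterminate occur without changing the image or the class modulo the
  minors. Each exchange raises one index and lowers that of another factor; the bound on the
  exponent of \<open>t\<close> guarantees a factor that can be lowered.\<close>

lemma raise_index:
  assumes "i \<in> Poly_Mapping.keys m" "Poly_Mapping.keys m \<subseteq> V"
    and "row_start c i = row_start c j" "i \<le> j" "j < t"
    and "j - row_start c j \<le> Poly_Mapping.lookup (W m) t"
  shows "\<exists>m'. j \<in> Poly_Mapping.keys m' \<and> Poly_Mapping.keys m' \<subseteq> V \<and> W m' = W m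
    \<and> monom m - monom m' \<in> (I_ideal c d :: 'k::comm_ring_1 mpoly set)"
  using assms
proof (induction "j - i" arbitrary: i m)
  case 0
  interpret ideal_of_subring "carrier (R_ring c d)" "I_ideal c d :: 'k mpoly set"
    by (rule ideal_of_subring_R_ring) (rule ideal_I_ideal)
  show ?case using 0 zero_P by (intro exI[of _ m]) auto
next
  case (Suc n)
  interpret ideal_of_subring "carrier (R_ring c d)" "I_ideal c d :: 'k mpoly set"
    by (rule ideal_of_subring_R_ring) (rule ideal_I_ideal)
  have ij: "i < j" using Suc.hyps(2) by simp
  then have i: "i \<le> c + d" "i \<noteq> c" and Suc_i: "row_start c (Suc i) = row_start c i"
    using Suc.prems by (auto simp: row_start_def split: if_splits)
  obtain m1 where m1: "m = e i + m1" "Poly_Mapping.keys m1 \<subseteq> Poly_Mapping.keys m"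
    using poly_mapping_split_key[OF Suc.prems(1)] .
  have "Poly_Mapping.lookup (W m) t = (i - row_start c i) + Poly_Mapping.lookup (W m1) t"
    using i by (simp add: m1 W.add lookup_add lookup_scroll_exp flip: One_nat_def)
  moreover have "i - row_start c i < j - row_start c j"
    using Suc.prems(3) ij by (auto simp: row_start_def split: if_splits)
  \<comment> \<open>The factor \<open>i\<close> accounts for less than the offset of
    \<open>j\<close>, so some other factor has positive offset.\<close>
  ultimately have "Poly_Mapping.lookup (W m1) t \<noteq> 0"
    using Suc.prems(6) by linarith
  then obtain l' where l': "l' \<in> Poly_Mapping.keys m1" "Poly_Mapping.lookup (E l') t \<noteq> 0"
    by (auto simp: lookup_lin_ext)
  then have l't: "l' < t" using m1(2) Suc.prems(2) by auto
  define l where "l = l' - 1"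
  \<comment> \<open>With positive offset, \<open>l'\<close> is not the first of its block, so its
    predecessor lies in the same block and is not \<open>c\<close>.\<close>
  have l: "l' = Suc l" "l \<le> c + d" "l \<noteq> c"
    using l'(2) l't lookup_scroll_exp(1)[OF l't] by (auto simp: l_def row_start_def split: if_splits)
  obtain r where r: "m1 = e (Suc l) + r" "Poly_Mapping.keys r \<subseteq> Poly_Mapping.keys m1"
    using poly_mapping_split_key[OF l'(1)] l(1) by metis
  have rV: "Poly_Mapping.keys r \<subseteq> V" using r(2) m1(2) Suc.prems(2) by blast
  define m2 where "m2 = e (Suc i) + (e l + r)"
  have m2_keys: "Suc i \<in> Poly_Mapping.keys m2"
    by (simp add: m2_def in_keys_iff lookup_add)
  have "Poly_Mapping.keys m2 \<subseteq> {Suc i, l} \<union> Poly_Mapping.keys r"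
    by (auto simp: m2_def in_keys_iff lookup_add lookup_single when_def split: if_splits)
  then have m2V: "Poly_Mapping.keys m2 \<subseteq> V"
    using i l rV by auto
  have W2: "W m2 = W m"
    using scroll_exp_exchange[OF i(1) l(2) i(2) l(3)]
    by (simp add: m2_def m1 r W.add add.assoc[symmetric] flip: One_nat_def)
  have step: "monom m - monom m2 \<in> (I_ideal c d :: 'k mpoly set)"
    using exchange_in_I_ideal[OF i(1) l(2) i(2) l(3) rV] by (simp add: m1 r m2_def)
  have "n = j - Suc i" using Suc.hyps(2) by simp
  then obtain m' where m': "j \<in> Poly_Mapping.keys m'" "Poly_Mapping.keys m' \<subseteq> V" "W m' = W m2"
    "monom m2 - monom m' \<in> (I_ideal c d :: 'k mpoly set)"
    using Suc.hyps(1)[of "Suc i" m2] Suc.hyps(2) m2_keys m2V Suc_i Suc.prems(3,5,6) ij W2 by auto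
  show ?case
    using m' W2 add_P[OF step m'(4)] by (intro exI[of _ m']) simp
qed

text \<open>Induction on the degree, read off the image as the joint exponent of \<open>u\<close>
  and \<open>v\<close> at the indices 0 and \<open>c + 1\<close>. Equal images put indeterminates of
  a common block into both monomials; raising the smaller index to the larger creates a common
  factor, which is split off.\<close>

lemma binomial_in_I_ideal:
  assumes "Poly_Mapping.keys m \<subseteq> V" "Poly_Mapping.keys n \<subseteq> V" "W m = W n"
  shows "monom m - monom n \<in> (I_ideal c d :: 'k::comm_ring_1 mpoly set)"
  using assms
proof (induction "Poly_Mapping.lookup (W m) 0 + Poly_Mapping.lookup (W m) (Suc c)"
    arbitrary: m n rule: less_induct)
  case less
  interpret ideal_of_subring "carrier (R_ring c d)" "I_ideal c d :: 'k mpoly set"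
    by (rule ideal_of_subring_R_ring) (rule ideal_I_ideal)
  have same_row: "\<exists>j\<in>Poly_Mapping.keys n. row_start c j = row_start c i"
    if i: "i \<in> Poly_Mapping.keys m" and mV: "Poly_Mapping.keys m \<subseteq> V" and nV: "Poly_Mapping.keys n \<subseteq> V"
      and W: "W m = W n" for m n i
  proof -
    have it: "i < t" and rt: "row_start c i < t" using i mV by (auto simp: row_start_def)
    have "Poly_Mapping.lookup (W m) (row_start c i) \<noteq> 0"
      using i it rt by (auto simp: lookup_lin_ext in_keys_iff lookup_scroll_exp(2) intro!: bexI[of _ i])
    then obtain j where "j \<in> Poly_Mapping.keys n" "Poly_Mapping.lookup (E j) (row_start c i) \<noteq> 0"
      unfolding W by (auto simp: lookup_lin_ext)
    moreover from this have "j < t" using nV by auto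
    ultimately show ?thesis
      using lookup_scroll_exp(2)[of j, OF _ rt] by (auto split: if_splits)
  qed
  \<comment> \<open>The bound demanded by \<open>raise_index\<close>; it passes from one monomial to
    the other because their images agree.\<close>
  have degree: "i - row_start c i \<le> Poly_Mapping.lookup (W m) t"
    if i: "i \<in> Poly_Mapping.keys m" and mV: "Poly_Mapping.keys m \<subseteq> V" for m i
  proof -
    obtain m' where "m = e i + m'" using poly_mapping_split_key[OF i] .
    then show ?thesis
      using i mV by (auto simp: W.add lookup_add lookup_scroll_exp simp flip: One_nat_def)
  qed
  show ?case
  proof (cases "m = 0 \<or> n = 0")
    case True
    have "(\<exists>i. i \<in> Poly_Mapping.keys m) \<longleftrightarrow> (\<exists>i. i \<in> Poly_Mapping.keys n)"
      using same_row[of _ m n] same_row[of _ n m] less.prems by metis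
    then have "m = n" using True by (metis keys_eq_empty all_not_in_conv)
    then show ?thesis by (simp add: zero_P)
  next
    case False
    then obtain i where i: "i \<in> Poly_Mapping.keys m" by fastforce
    obtain j where j: "j \<in> Poly_Mapping.keys n" "row_start c j = row_start c i"
      using same_row[OF i less.prems] by blast
    have it: "i < t" and jt: "j < t" using i j less.prems by auto
    have "\<exists>k m' n'. k \<in> Poly_Mapping.keys m' \<and> k \<in> Poly_Mapping.keys n'
      \<and> Poly_Mapping.keys m' \<subseteq> V \<and> Poly_Mapping.keys n' \<subseteq> V \<and> W m' = W m \<and> W n' = W n
      \<and> monom m - monom m' \<in> (I_ideal c d :: 'k mpoly set) \<and> monom n - monom n' \<in> (I_ideal c d :: 'k mpoly set)"
    proof (cases "i \<le> j")
      case True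
      have "j - row_start c j \<le> Poly_Mapping.lookup (W m) t"
        using degree[OF j(1) less.prems(2)] less.prems(3) by simp
      from raise_index[OF i less.prems(1) j(2)[symmetric] True jt this] obtain m' where
        "j \<in> Poly_Mapping.keys m'" "Poly_Mapping.keys m' \<subseteq> V" "W m' = W m"
        "monom m - monom m' \<in> (I_ideal c d :: 'k mpoly set)" by blast
      then show ?thesis
        using j(1) less.prems(2) zero_P by (intro exI[of _ j] exI[of _ m'] exI[of _ n]) simp
    next
      case False
      have "i - row_start c i \<le> Poly_Mapping.lookup (W n) t"
        using degree[OF i less.prems(1)] less.prems(3) by simp
      from raise_index[OF j(1) less.prems(2) j(2) _ it this] False obtain n' where
        "i \<in> Poly_Mapping.keys n'" "Poly_Mapping.keys n' \<subseteq> V" "W n' = W n"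
        "monom n - monom n' \<in> (I_ideal c d :: 'k mpoly set)" by auto
      then show ?thesis
        using i less.prems(1) zero_P by (intro exI[of _ i] exI[of _ m] exI[of _ n']) simp
    qed
    then obtain k m' n' where k: "k \<in> Poly_Mapping.keys m'" "k \<in> Poly_Mapping.keys n'"
      and V: "Poly_Mapping.keys m' \<subseteq> V" "Poly_Mapping.keys n' \<subseteq> V" and W: "W m' = W m" "W n' = W n"
      and I: "monom m - monom m' \<in> (I_ideal c d :: 'k mpoly set)" "monom n - monom n' \<in> (I_ideal c d :: 'k mpoly set)"
      by blast
    obtain m1 where m1: "m' = e k + m1" "Poly_Mapping.keys m1 \<subseteq> Poly_Mapping.keys m'"
      using poly_mapping_split_key[OF k(1)] .
    obtain n1 where n1: "n' = e k + n1" "Poly_Mapping.keys n1 \<subseteq> Poly_Mapping.keys n'"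
      using poly_mapping_split_key[OF k(2)] .
    have kt: "k < t" using k V by auto
    have Wm: "W m = E k + W m1" and Wn: "W n = E k + W n1"
      using W by (simp_all add: m1 n1 W.add flip: One_nat_def)
    have "Poly_Mapping.lookup (E k) 0 + Poly_Mapping.lookup (E k) (Suc c) > 0"
      using kt by (simp add: lookup_scroll_exp(2)) (simp add: row_start_def)
    then have "monom m1 - monom n1 \<in> (I_ideal c d :: 'k mpoly set)"
      using less.hyps[of m1 n1] m1(2) n1(2) V Wm Wn less.prems(3) by (auto simp: lookup_add)
    then have "indet k * (monom m1 - monom n1) \<in> (I_ideal c d :: 'k mpoly set)"
      by (rule mult_P[OF indet_in_R_ring[OF kt]])
    then have "monom m' - monom n' \<in> (I_ideal c d :: 'k mpoly set)"
      by (simp add: m1 n1 indet_def right_diff_distrib mult_single)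
    from diff_P[OF add_P[OF I(1) this] I(2)] show ?thesis by simp
  qed
qed

text \<open>The coefficients over each fibre of \<open>W\<close> add up to zero, so a monomial of
  \<open>p\<close> shares its fibre with another. Subtracting a multiple of their difference removes
  the first and leaves no new monomial.\<close>

lemma kernel_subset_I_ideal: "scroll_kernel c d V \<subseteq> (I_ideal c d :: 'k::comm_ring_1 mpoly set)"
proof
  interpret ideal_of_subring "carrier (R_ring c d)" "I_ideal c d :: 'k mpoly set"
    by (rule ideal_of_subring_R_ring) (rule ideal_I_ideal)
  fix p :: "'k mpoly" assume "p \<in> scroll_kernel c d V"
  then have "p \<in> carrier (R_ring c d)" "push W p = 0" by (auto simp: scroll_kernel_def)
  then show "p \<in> I_ideal c d"
  proof (induction "card (Poly_Mapping.keys p)" arbitrary: p rule: less_induct)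
    case less
    have V: "Poly_Mapping.keys m \<subseteq> V" if "m \<in> Poly_Mapping.keys p" for m
      using less.prems(1) that by (simp add: R_ring_def in_carrier_mpoly_ring)
    show ?case
    proof (cases "p = 0")
      case False
      then obtain m where m: "m \<in> Poly_Mapping.keys p" by fastforce
      let ?a = "Poly_Mapping.lookup p m"
      have "(\<Sum>n | n \<in> Poly_Mapping.keys p \<and> W n = W m. Poly_Mapping.lookup p n) = 0"
        using lookup_push[of W p "W m"] less.prems(2) by simp
      moreover have "{n \<in> Poly_Mapping.keys p. W n = W m}
          = insert m {n \<in> Poly_Mapping.keys p. W n = W m \<and> n \<noteq> m}"
        using m by auto
      moreover have "?a \<noteq> 0" using m by (simp add: in_keys_iff)
      ultimately have "{n \<in> Poly_Mapping.keys p. W n = W m \<and> n \<noteq> m} \<noteq> {}"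
        by (metis add.right_neutral finite.emptyI empty_iff sum.empty sum.insert)
      then obtain n where n: "n \<in> Poly_Mapping.keys p" "W n = W m" "n \<noteq> m" by blast
      define b where "b = Poly_Mapping.single 0 ?a * (monom m - monom n)"
      have b: "b \<in> I_ideal c d"
        unfolding b_def
        by (rule mult_P[OF single_in_R_ring binomial_in_I_ideal[OF V[OF m] V[OF n(1)] n(2)[symmetric]]]) simp
      have b_eq: "b = Poly_Mapping.single m ?a - Poly_Mapping.single n ?a"
        by (simp add: b_def right_diff_distrib mult_single)
      have "Poly_Mapping.keys (p - b) \<subseteq> Poly_Mapping.keys p - {m}"
        using n by (auto simp: b_eq in_keys_iff lookup_minus lookup_single when_def split: if_splits)
      then have "card (Poly_Mapping.keys (p - b)) < card (Poly_Mapping.keys p)"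
        using m by (intro psubset_card_mono) auto
      moreover have "push W (p - b) = 0"
        using less.prems(2) n by (simp add: b_eq push_diff)
      moreover have "p - b \<in> carrier (R_ring c d)"
        using less.prems(1) b P_subset by (intro diff_C) auto
      ultimately have "p - b \<in> I_ideal c d" using less.hyps by blast
      then have "(p - b) + b \<in> I_ideal c d" using b by (rule add_P)
      then show ?thesis by simp
    qed (simp add: zero_P)
  qed
qed

lemma I_ideal_eq_kernel: "I_ideal c d = (scroll_kernel c d V :: 'k::idom mpoly set)"
  using I_ideal_subset_kernel kernel_subset_I_ideal by blast

end

section \<open>Radicals and height\<close>

text \<open>An element of \<open>I\<close> outside the radical would be missed by some prime over
  \<open>J\<close>; the reverse inclusion rests on primality of \<open>I\<close>. Taking
  \<open>J\<close> to be \<open>I\<close> shows that \<open>I\<close> is radical.\<close>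

lemma Rad_eqI:
  fixes R (structure)
  assumes P: "primeideal I R" and J: "J \<subseteq> I" "ideal J R"
    and primes: "\<And>P. primeideal P R \<Longrightarrow> J \<subseteq> P \<Longrightarrow> I \<subseteq> P"
  shows "I = Rad R J"
proof -
  interpret primeideal I R by (rule P)
  show ?thesis
  proof (intro equalityI subsetI)
    fix a assume a: "a \<in> I"
    show "a \<in> Rad R J"
    proof (rule ccontr)
      assume "a \<notin> Rad R J"
      then obtain P where "primeideal P R" "J \<subseteq> P" "a \<notin> P"
        using exists_primeideal_avoiding_powers[OF J(2), of a] a Icarr by (auto simp: Rad_def)
      with primes a show False by blast
    qed
  next
    fix a assume "a \<in> Rad R J"
    then obtain n :: nat where a: "a \<in> carrier R" and n: "a [^] n \<in> I"
      using J by (auto simp: Rad_def)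
    have "a [^] n \<in> I \<Longrightarrow> a \<in> I" for n :: nat
    proof (induction n)
      case 0
      then show ?case using I_notcarr one_imp_carrier by simp
    next
      case (Suc n)
      then show ?case using a I_prime[of "a [^] n" a] by auto
    qed
    with n show "a \<in> I" by blast
  qed
qed

text \<open>The height is an infimum over all primes containing \<open>Q n\<close>. Replacing the
  top of the chain by any of them keeps it strict.\<close>

lemma height_ge:
  assumes Q: "\<And>i. i \<le> n \<Longrightarrow> primeideal (Q i) R" "\<And>i. i < n \<Longrightarrow> Q i \<subset> Q (Suc i)"
  shows "enat n \<le> height R (Q n)"
  unfolding height_def
proof (rule Inf_greatest)
  fix h assume "h \<in> {height_prime R P | P. primeideal P R \<and> Q n \<subseteq> P}"
  then obtain P where h: "h = height_prime R P" and P: "primeideal P R" "Q n \<subseteq> P" by blast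
  define Q' where "Q' i = (if i < n then Q i else P)" for i
  have "\<forall>i\<le>n. primeideal (Q' i) R"
    using Q(1) P(1) by (simp add: Q'_def)
  moreover have "\<forall>i<n. Q' i \<subset> Q' (Suc i)"
  proof (intro allI impI)
    fix i assume i: "i < n"
    then have "Q' (Suc i) = (if Suc i = n then P else Q (Suc i))" by (auto simp: Q'_def)
    then show "Q' i \<subset> Q' (Suc i)"
      using Q(2)[OF i] P(2) i by (auto simp: Q'_def)
  qed
  moreover have "Q' n = P" by (simp add: Q'_def)
  ultimately show "enat n \<le> h"
    unfolding h height_prime_def by (intro Sup_upper) blast
qed

section \<open>The generators and their radical\<close>

lemma F_poly_eq: "F_poly i = scroll_form xvar (xvar (i + 1)) (xvar i) i"
  by (simp add: F_poly_def scroll_form_def)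

lemma F_last_eq: "F_last c = scroll_form xvar (yvar c 1) (yvar c 0) c"
  by (simp add: F_last_def scroll_form_def)

lemma G_poly_eq: "G_poly c i = scroll_form (yvar c) (yvar c (i + 1)) (yvar c i) i"
  by (simp add: G_poly_def scroll_form_def)

lemma (in monomial_map) push_scroll_form:
  "push w (scroll_form z a b n :: 'a \<Rightarrow>\<^sub>0 'k::comm_ring_1) = scroll_form (\<lambda>k. push w (z k)) (push w a) (push w b) n"
  by (simp add: scroll_form_def push_hom)

lemma (in ideal_of_subring) scroll_form_C:
  assumes "\<And>k. k \<le> n \<Longrightarrow> z k \<in> C" "a \<in> C" "b \<in> C"
  shows "scroll_form z a b n \<in> C"
  unfolding scroll_form_def by (intro C_intros assms) auto

definition scroll_generators :: "nat \<Rightarrow> nat \<Rightarrow> 'k::comm_ring_1 mpoly set" where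
  "scroll_generators c d = F_poly ` {1..c - 1} \<union> {F_last c} \<union> G_poly c ` {1..d - 1}
     \<union> {xvar 0 * yvar c d - xvar 1 * yvar c (d - 1)}"

text \<open>In each form the base \<open>a - t * b\<close> is sent to zero, because consecutive
  entries of a block have ratio \<open>t\<close> on the scroll.\<close>

lemma scroll_generators_subset:
  assumes "2 \<le> c" "2 \<le> d"
  shows "scroll_generators c d \<subseteq> (I_ideal c d :: 'k::idom mpoly set)"
proof -
  let ?V = "{..<c + d + 2}"
  let ?\<phi> = "push (scroll_map c d ?V) :: 'k mpoly \<Rightarrow> 'k mpoly"
  interpret W: monomial_map "scroll_map c d ?V" by (rule monomial_map_lin_ext)
  interpret ideal_of_subring "carrier (R_ring c d)" "I_ideal c d :: 'k mpoly set"
    by (rule ideal_of_subring_R_ring) (rule ideal_I_ideal)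
  let ?u = "indet 0 :: 'k mpoly" and ?v = "indet (Suc c) :: 'k mpoly" and ?t = "indet (c + d + 2) :: 'k mpoly"
  have x: "?\<phi> (xvar k) = ?u * ?t ^ k" if "k \<le> c" for k
    using that by (simp add: xvar_def push_scroll_indet row_start_def)
  have y: "?\<phi> (yvar c k) = ?v * ?t ^ k" if "k \<le> d" for k
    using that by (simp add: yvar_def push_scroll_indet row_start_def)
  have xC: "xvar k \<in> carrier (R_ring c d :: 'k mpoly ring)" if "k \<le> c" for k
    using that unfolding xvar_def by (intro indet_in_R_ring) simp
  have yC: "yvar c k \<in> carrier (R_ring c d :: 'k mpoly ring)" if "k \<le> d" for k
    using that unfolding yvar_def by (intro indet_in_R_ring) simp
  have mem: "p \<in> I_ideal c d" if "p \<in> carrier (R_ring c d)" "?\<phi> p = 0" for p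
    using that unfolding I_ideal_eq_kernel by (simp add: scroll_kernel_def)
  have "F_poly i \<in> (I_ideal c d :: 'k mpoly set)" if "i \<in> {1..c - 1}" for i
  proof (rule mem)
    have i: "0 < i" "i + 1 \<le> c" using that assms by auto
    show "F_poly i \<in> carrier (R_ring c d :: 'k mpoly ring)"
      unfolding F_poly_eq using i by (intro scroll_form_C xC) auto
    have "?\<phi> (F_poly i) = ?u * (?\<phi> (xvar (i + 1)) - ?t * ?\<phi> (xvar i)) ^ i"
      unfolding F_poly_eq W.push_scroll_form using i by (intro scroll_form_geometric x) simp
    \<comment> \<open>Positivity of \<open>i\<close> matters: \<open>0 ^ 0\<close> would be
      1.\<close>
    then show "?\<phi> (F_poly i) = 0"
      using i by (simp add: x)
  qed
  moreover have "G_poly c i \<in> (I_ideal c d :: 'k mpoly set)" if "i \<in> {1..d - 1}" for i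
  proof (rule mem)
    have i: "0 < i" "i + 1 \<le> d" using that assms by auto
    show "G_poly c i \<in> carrier (R_ring c d :: 'k mpoly ring)"
      unfolding G_poly_eq using i by (intro scroll_form_C yC) auto
    have "?\<phi> (G_poly c i) = ?v * (?\<phi> (yvar c (i + 1)) - ?t * ?\<phi> (yvar c i)) ^ i"
      unfolding G_poly_eq W.push_scroll_form using i by (intro scroll_form_geometric y) simp
    then show "?\<phi> (G_poly c i) = 0"
      using i by (simp add: y)
  qed
  moreover have "F_last c \<in> (I_ideal c d :: 'k mpoly set)"
  proof (rule mem)
    show "F_last c \<in> carrier (R_ring c d :: 'k mpoly ring)"
      unfolding F_last_eq using assms by (intro scroll_form_C xC yC) auto
    have "?\<phi> (F_last c) = ?u * (?\<phi> (yvar c 1) - ?t * ?\<phi> (yvar c 0)) ^ c"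
      unfolding F_last_eq W.push_scroll_form by (intro scroll_form_geometric x)
    then show "?\<phi> (F_last c) = 0"
      using assms by (simp add: y)
  qed
  moreover have "xvar 0 * yvar c d - xvar 1 * yvar c (d - 1) \<in> (I_ideal c d :: 'k mpoly set)"
  proof (rule mem)
    show "xvar 0 * yvar c d - xvar 1 * yvar c (d - 1) \<in> carrier (R_ring c d :: 'k mpoly ring)"
      using assms by (intro C_intros xC yC) auto
    show "?\<phi> (xvar 0 * yvar c d - xvar 1 * yvar c (d - 1)) = 0"
      using assms by (simp add: W.push_hom x y) (simp add: ac_simps flip: power_Suc)
  qed
  ultimately show ?thesis by (auto simp: scroll_generators_def)
qed

lemma minors_in_prime:
  assumes cd: "2 \<le> c" "2 \<le> d"
    and P: "primeideal P (R_ring c d)" "scroll_generators c d \<subseteq> (P :: 'k::idom mpoly set)"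
  shows "minors 2 (A_mat c d) \<subseteq> P"
proof
  interpret prime_of_subring "carrier (R_ring c d)" P
    by (rule prime_of_subring_R_ring) (rule P(1))
  fix p :: "'k mpoly" assume "p \<in> minors 2 (A_mat c d)"
  then obtain i j where p: "p = scroll_minor i j" and ij: "i < j" "j \<le> c + d" "i \<noteq> c" "j \<noteq> c"
    unfolding minors_A_mat by blast
  let ?x = "xvar :: nat \<Rightarrow> 'k mpoly" and ?y = "yvar c :: nat \<Rightarrow> 'k mpoly"
  let ?cols = "(\<lambda>i. (?x i, ?x (Suc i))) ` {..<c} \<union> (\<lambda>i. (?y i, ?y (Suc i))) ` {..<d}"
  have col: "(indet k, indet (Suc k)) \<in> ?cols" if "k \<le> c + d" "k \<noteq> c" for k
  proof (cases "k < c")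
    case True
    then show ?thesis by (auto simp: xvar_def)
  next
    case False
    then have "k = c + 1 + (k - Suc c)" "k - Suc c < d" using that by auto
    then show ?thesis
      by (intro UnI2 image_eqI[of _ _ "k - Suc c"]) (auto simp: yvar_def)
  qed
  have "indet i * indet (Suc j) - indet j * indet (Suc i) \<in> P"
  proof (rule scroll_minors_in_prime[of c d ?x ?y])
    show "?x k \<in> carrier (R_ring c d)" if "k \<le> c" for k
      using that unfolding xvar_def by (intro indet_in_R_ring) simp
    show "?y k \<in> carrier (R_ring c d)" if "k \<le> d" for k
      using that unfolding yvar_def by (intro indet_in_R_ring) simp
    show "scroll_form ?x (?x (i + 1)) (?x i) i \<in> P" if "1 \<le> i" "i < c" for i
      using that P(2) unfolding F_poly_eq[symmetric] scroll_generators_def by auto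
    show "scroll_form ?y (?y (i + 1)) (?y i) i \<in> P" if "1 \<le> i" "i < d" for i
      using that P(2) unfolding G_poly_eq[symmetric] scroll_generators_def by auto
    show "scroll_form ?x (?y 1) (?y 0) c \<in> P" "?x 0 * ?y d - ?x 1 * ?y (d - 1) \<in> P"
      using P(2) unfolding F_last_eq[symmetric] scroll_generators_def by auto
  qed (use cd ij col in auto)
  then show "p \<in> P" by (simp add: p scroll_minor_def)
qed

theorem corollary3:
  fixes c d :: nat
  assumes "c \<ge> 2" and "d \<ge> 2"
  shows "(I_ideal c d :: 'k::alg_closed_field mpoly set) =
           Rad (R_ring c d) (Idl\<^bsub>R_ring c d\<^esub>
             (F_poly ` {1..c - 1} \<union> {F_last c} \<union> G_poly c ` {1..d - 1}
              \<union> {xvar 0 * yvar c d - xvar 1 * yvar c (d - 1)}))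
         \<and> almost_stci (R_ring c d) (I_ideal c d :: 'k mpoly set)"
proof -
  let ?R = "R_ring c d :: 'k mpoly ring" and ?I = "I_ideal c d :: 'k mpoly set"
    and ?G = "scroll_generators c d :: 'k mpoly set"
  interpret R: cring ?R by (rule cring_R_ring)
  have prime_I: "primeideal ?I ?R"
    unfolding I_ideal_eq_kernel by (rule primeideal_scroll_kernel)
  have I_carrier: "?I \<subseteq> carrier ?R"
    using ideal.Icarr[OF ideal_I_ideal] by blast
  have G: "?G \<subseteq> ?I" by (rule scroll_generators_subset[OF assms])
  then have G_carrier: "?G \<subseteq> carrier ?R" using I_carrier by blast
  have I: "?I = Rad ?R (Idl\<^bsub>?R\<^esub> ?G)"
  proof (rule Rad_eqI[OF prime_I])
    show "Idl\<^bsub>?R\<^esub> ?G \<subseteq> ?I"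
      by (rule R.genideal_minimal[OF ideal_I_ideal G])
    show "ideal (Idl\<^bsub>?R\<^esub> ?G) ?R"
      by (rule R.genideal_ideal[OF G_carrier])
    fix P assume P: "primeideal P ?R" "Idl\<^bsub>?R\<^esub> ?G \<subseteq> P"
    have "?G \<subseteq> P" using R.genideal_self[OF G_carrier] P(2) by blast
    then show "?I \<subseteq> P"
      unfolding I_ideal_def
      by (intro R.genideal_minimal primeideal.axioms(1) minors_in_prime assms P(1))
  qed
  have "Rad ?R ?I = ?I"
    by (rule Rad_eqI[OF prime_I _ ideal_I_ideal, symmetric]) auto
  define Ps :: "'k mpoly list" where
    "Ps = map F_poly [1..<c] @ F_last c # map (G_poly c) [1..<d]
       @ [xvar 0 * yvar c d - xvar 1 * yvar c (d - 1)]"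
  have atLeast: "{1..c - 1} = {1..<c}" "{1..d - 1} = {1..<d}" using assms by auto
  have "set Ps = ?G"
    unfolding Ps_def scroll_generators_def atLeast by auto
  then have "generates_up_to_radical ?R Ps ?I"
    using G_carrier I \<open>Rad ?R ?I = ?I\<close> by (simp add: generates_up_to_radical_def)
  moreover have "enat (length Ps) \<le> height ?R ?I + 1"
  proof -
    obtain Q :: "nat \<Rightarrow> 'k mpoly set" where
      Q: "\<forall>i\<le>c + d - 1. primeideal (Q i) ?R" "\<forall>i<c + d - 1. Q i \<subset> Q (Suc i)"
        "Q (c + d - 1) = ?I"
      unfolding I_ideal_eq_kernel using scroll_kernel_chain[of c d] assms by auto
    have "enat (c + d - 1) \<le> height ?R ?I"
      using height_ge[of "c + d - 1" Q ?R] Q by auto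
    then have "enat (c + d - 1) + 1 \<le> height ?R ?I + 1"
      by (rule add_right_mono)
    \<comment> \<open>The list has (c - 1) + 1 + (d - 1) + 1 entries, one more than the chain has
      inclusions.\<close>
    moreover have "enat (length Ps) = enat (c + d - 1) + 1"
      using assms by (simp add: Ps_def one_enat_def)
    ultimately show ?thesis by simp
  qed
  ultimately have "almost_stci ?R ?I"
    unfolding almost_stci_def using ideal_I_ideal by blast
  then show ?thesis
    using I unfolding scroll_generators_def by blast
qed

end
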